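(* Let $n\ge 1$ and let $\Lambda\subset\mathbf{R}^{n}$ be a lattice with $\mathbf{Z}^{n}\subseteq\Lambda$. For $i=1,\ldots,n$ let $\pi_{i}:\Lambda/\mathbf{Z}^{n}\to\mathbf{R}/\mathbf{Z}$ be the coordinate projection $(\lambda_{1},\ldots,\lambda_{n})+\mathbf{Z}^{n}\mapsto\lambda_{i}+\mathbf{Z}$, and assume that $\ker\pi_{i}\neq\Lambda/\mathbf{Z}^{n}$ for every $i$. Let $u=(u_{1},\ldots,u_{n})\in\mathbf{R}^{n}$. Then $\langle u,\lambda\rangle=u_1\lambda_1+\cdots+u_n\lambda_n=0$ for every $\lambda\in\Lambda\cap[0,1)^{n}$ if and only if, for each $j=1,2,\ldots,n$, both \[ \sum_{\substack{1\le i\le n\\ \pi_{i}=\pi_{j}}}u_{i}=\sum_{\substack{1\le i\le n\\ \pi_{i}=-\pi_{j}}}u_{i} \qquad\text{and}\qquad \sum_{\substack{1\le i\le n\\ \ker\pi_{i}=\ker\pi_{j}}}u_{i}=0 \] hold.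
   Context: $[0,1)^n=\{x\in\mathbf{R}^n: 0\le x_i<1 \text{ for all } i\}$. The maps $\pi_i$ are group homomorphisms, elements of the additive group $\mathrm{Hom}_{\mathbf{Z}}(\Lambda/\mathbf{Z}^n,\mathbf{R}/\mathbf{Z})$ under pointwise addition, so $-\pi_j$ denotes the homomorphism $x\mapsto-\pi_j(x)$. Equalities $\pi_i=\pm\pi_j$ are equalities of homomorphisms. *)

theory Defs
  imports "HOL-Analysis.Analysis" "HOL-Algebra.Coset"
begin

definition additive_group :: "'a::ab_group_add set \<Rightarrow> 'a monoid" where
  "additive_group A = \<lparr>carrier = A, mult = (+), one = 0\<rparr>"

definition is_lattice :: "(real ^ 'n) set \<Rightarrow> bool" where
  "is_lattice L \<longleftrightarrow> subgroup L (additive_group UNIV) \<and> discrete L \<and> span L = UNIV"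

definition Zn :: "(real ^ 'n) set" where
  "Zn = {x. \<forall>i. x $ i \<in> \<int>}"

definition half_open_cube :: "(real ^ 'n) set" where
  "half_open_cube = {x. \<forall>i. 0 \<le> x $ i \<and> x $ i < 1}"

abbreviation mod_Zn :: "(real ^ 'n) set \<Rightarrow> (real ^ 'n) set monoid" where
  "mod_Zn L \<equiv> additive_group L Mod Zn"

abbreviation R_mod_Z :: "real set monoid" where
  "R_mod_Z \<equiv> additive_group UNIV Mod \<int>"

text \<open>The set of \<open>i\<close>-th coordinates of the elements of the coset of \<open>x\<close> modulo \<open>Zn\<close> is
  exactly the coset of \<open>x $ i\<close> modulo \<open>\<int>\<close>; see \<open>coord_proj_coset\<close> below.
  The maps are restricted to the carrier, so that equality of homomorphisms is equality in HOL.\<close>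

definition coord_proj :: "(real ^ 'n) set \<Rightarrow> 'n \<Rightarrow> (real ^ 'n) set \<Rightarrow> real set" where
  "coord_proj L i = (\<lambda>X\<in>carrier (mod_Zn L). (\<lambda>x. x $ i) ` X)"

definition neg_hom :: "('a, 'c) monoid_scheme \<Rightarrow> ('b, 'd) monoid_scheme \<Rightarrow> ('a \<Rightarrow> 'b) \<Rightarrow> 'a \<Rightarrow> 'b" where
  "neg_hom G H h = (\<lambda>x\<in>carrier G. inv\<^bsub>H\<^esub> (h x))"

abbreviation coord_ker :: "(real ^ 'n) set \<Rightarrow> 'n \<Rightarrow> (real ^ 'n) set set" where
  "coord_ker L i \<equiv> kernel (mod_Zn L) R_mod_Z (coord_proj L i)"

lemma comm_group_additive_group:
  assumes "0 \<in> A" "\<And>x y. x \<in> A \<Longrightarrow> y \<in> A \<Longrightarrow> x + y \<in> A" "\<And>x. x \<in> A \<Longrightarrow> - x \<in> A"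
  shows "comm_group (additive_group A)"
  using assms
  by (intro comm_groupI)
     (auto simp: additive_group_def algebra_simps intro!: bexI[where x = "- x" for x])

lemma comm_group_additive_UNIV: "comm_group (additive_group UNIV)"
  by (rule comm_group_additive_group) auto

lemma inv_additive_UNIV: "inv\<^bsub>additive_group UNIV\<^esub> x = - x"
  by (rule group.inv_equality[OF comm_group.axioms(2)[OF comm_group_additive_UNIV]])
     (auto simp: additive_group_def)

lemma comm_group_lattice:
  assumes "is_lattice L"
  shows "comm_group (additive_group L)"
proof -
  have sg: "subgroup L (additive_group UNIV)"
    using assms by (simp add: is_lattice_def)
  show ?thesis
    using subgroup.one_closed[OF sg] subgroup.m_closed[OF sg] subgroup.m_inv_closed[OF sg]
    by (intro comm_group_additive_group) (auto simp: inv_additive_UNIV, auto simp: additive_group_def)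
qed

lemma normal_Zn:
  assumes "is_lattice L" "Zn \<subseteq> L"
  shows "Zn \<lhd> additive_group L"
proof -
  interpret comm_group "additive_group L"
    by (rule comm_group_lattice[OF assms(1)])
  have inv: "inv\<^bsub>additive_group L\<^esub> x = - x" if "x \<in> Zn" for x
  proof (rule inv_equality)
    have "- x \<in> Zn" using that by (auto simp: Zn_def)
    then show "- x \<in> carrier (additive_group L)" "x \<in> carrier (additive_group L)"
      using assms(2) that by (auto simp: additive_group_def)
  qed (simp add: additive_group_def)
  have "subgroup Zn (additive_group L)"
  proof (rule subgroupI)
    show "Zn \<subseteq> carrier (additive_group L)"
      using assms(2) by (simp add: additive_group_def)
    show "Zn \<noteq> {}" by (auto simp: Zn_def intro!: exI[of _ 0])
    show "inv\<^bsub>additive_group L\<^esub> a \<in> Zn" if "a \<in> Zn" for a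
      using that by (auto simp: inv) (auto simp: Zn_def)
    show "a \<otimes>\<^bsub>additive_group L\<^esub> b \<in> Zn" if "a \<in> Zn" "b \<in> Zn" for a b
      using that by (auto simp: additive_group_def Zn_def)
  qed
  then show ?thesis by (rule subgroup_imp_normal)
qed

lemma normal_Ints: "(\<int> :: real set) \<lhd> additive_group UNIV"
proof -
  interpret comm_group "additive_group (UNIV :: real set)"
    by (rule comm_group_additive_UNIV)
  have "subgroup (\<int> :: real set) (additive_group UNIV)"
    by (rule subgroupI) (auto simp: inv_additive_UNIV, auto simp: additive_group_def)
  then show ?thesis by (rule subgroup_imp_normal)
qed

lemma coord_image_coset:
  "(\<lambda>y. y $ i) ` (Zn #>\<^bsub>additive_group L\<^esub> x) = \<int> #>\<^bsub>additive_group UNIV\<^esub> (x $ i)"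
proof -
  have "\<exists>z\<in>Zn. k = z $ i" if "k \<in> \<int>" for k :: real
    using that by (intro bexI[of _ "\<chi> _. k"]) (auto simp: Zn_def)
  then show ?thesis
    by (fastforce simp: r_coset_def additive_group_def Zn_def image_iff)
qed

lemma coord_proj_coset:
  assumes "x \<in> L"
  shows "coord_proj L i (Zn #>\<^bsub>additive_group L\<^esub> x) = \<int> #>\<^bsub>additive_group UNIV\<^esub> (x $ i)"
proof -
  have "x \<in> carrier (additive_group L)"
    using assms by (simp add: additive_group_def)
  then show ?thesis
    by (simp add: coord_proj_def coord_image_coset carrier_FactGroup)
qed

lemma coord_proj_hom:
  assumes "is_lattice L" "Zn \<subseteq> L"
  shows "coord_proj L i \<in> hom (mod_Zn L) R_mod_Z"
proof (rule homI)
  interpret A: normal Zn "additive_group L" by (rule normal_Zn[OF assms])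
  interpret R: normal "\<int> :: real set" "additive_group UNIV" by (rule normal_Ints)
  have carL: "carrier (additive_group L) = L" by (simp add: additive_group_def)
  show "coord_proj L i X \<in> carrier R_mod_Z" if "X \<in> carrier (mod_Zn L)" for X
    using that carL by (auto simp: carrier_FactGroup coord_proj_coset) (auto simp: additive_group_def)
  fix X Y assume "X \<in> carrier (mod_Zn L)" "Y \<in> carrier (mod_Zn L)"
  then obtain x y where xy: "x \<in> L" "y \<in> L"
    and X: "X = Zn #>\<^bsub>additive_group L\<^esub> x" and Y: "Y = Zn #>\<^bsub>additive_group L\<^esub> y"
    using carL by (auto simp: carrier_FactGroup)
  have mem: "x \<otimes>\<^bsub>additive_group L\<^esub> y \<in> L"
    using A.m_closed[of x y] xy by (simp add: carL)
  have "coord_proj L i (X \<otimes>\<^bsub>mod_Zn L\<^esub> Y)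
      = \<int> #>\<^bsub>additive_group UNIV\<^esub> ((x \<otimes>\<^bsub>additive_group L\<^esub> y) $ i)"
    using xy mem by (simp add: X Y A.rcos_sum carL coord_proj_coset)
  also have "(x \<otimes>\<^bsub>additive_group L\<^esub> y) $ i = x $ i \<otimes>\<^bsub>additive_group UNIV\<^esub> y $ i"
    by (simp add: additive_group_def)
  also have "\<int> #>\<^bsub>additive_group UNIV\<^esub> (x $ i \<otimes>\<^bsub>additive_group UNIV\<^esub> y $ i)
      = coord_proj L i X \<otimes>\<^bsub>R_mod_Z\<^esub> coord_proj L i Y"
    using xy R.rcos_sum[of "x $ i" "y $ i"]
    by (simp add: X Y coord_proj_coset) (simp add: additive_group_def)
  finally show "coord_proj L i (X \<otimes>\<^bsub>mod_Zn L\<^esub> Y)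
      = coord_proj L i X \<otimes>\<^bsub>R_mod_Z\<^esub> coord_proj L i Y" .
qed

end

theory Submission
  imports Defs "HOL-Number_Theory.Prime_Powers" "HOL-Number_Theory.Cong"
    "HOL-Computational_Algebra.Squarefree" "HOL-Library.Landau_Symbols"
begin

text \<open>
  Reducing modulo \<open>\<int>\<^sup>n\<close>, the condition on the left says that \<open>\<Sum> u\<^sub>i frac(x\<^sub>i) = 0\<close> for all \<open>x \<in> \<Lambda>\<close>.
  Its even part under \<open>x \<mapsto> - x\<close> is \<open>\<Sum> u\<^sub>i (1 - [x \<in> ker \<pi>\<^sub>i]) = 0\<close>; summed against the character
  \<open>cos (2 \<pi> x\<^sub>j)\<close> over the finite group \<open>\<Lambda> / \<int>\<^sup>n\<close> it becomes a system that is triangular with respect to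
  inclusion of kernels. The odd part is \<open>\<Sum> u\<^sub>i B(x\<^sub>i) = 0\<close> for the sawtooth \<open>B(t) = - \<Sum> sin (2 \<pi> k t) / (\<pi> k)\<close>;
  taking Fourier coefficients on the same group turns it into \<open>\<Sum>\<^sub>k \<Phi>(a k) / k = 0\<close> for every \<open>a \<ge> 1\<close>, where
  \<open>\<Phi>\<close> is odd and periodic and \<open>\<Phi>(1)\<close> is proportional to the difference of the two sums in the first condition.

  That such a \<open>\<Phi>\<close> vanishes is equivalent to the nonvanishing of \<open>L(1, \<chi>)\<close>, and is proved without
  decomposing into Dirichlet characters. Elementary estimates of Mertens type show that a nonzero solution
  supported on residues prime to \<open>M\<close> is negated by almost all primes in the sense of logarithmic density,
  which forces it to be a multiple of a real character; and for a real character \<open>L(1, \<chi>) = 0\<close> is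
  impossible because the Lambert series \<open>\<Sum> \<chi>(d) t\<^sup>d / (1 - t\<^sup>d)\<close>, which has nonnegative coefficients that are
  at least 1 at squares, would stay bounded as \<open>t\<close> tends to 1.
\<close>

section \<open>Series with bounded partial sums of coefficients\<close>

text \<open>Pairs with \<open>d dvd n\<close> correspond to pairs \<open>(d, j)\<close> with
  \<open>n = d * j\<close>. Every sum of a Dirichlet convolution below is rearranged through this
  exchange.\<close>

lemma sum_divisors_swap:
  fixes h :: "nat \<Rightarrow> nat \<Rightarrow> 'a::comm_monoid_add"
  shows "(\<Sum>n=1..N. \<Sum>d | d dvd n. h d (n div d)) = (\<Sum>d=1..N. \<Sum>j=1..N div d. h d j)"
proof -
  have "(\<Sum>n=1..N. \<Sum>d | d dvd n. h d (n div d))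
      = (\<Sum>(n, d)\<in>(SIGMA n:{1..N}. {d. d dvd n}). h d (n div d))"
    by (rule sum.Sigma) auto
  also have "\<dots> = (\<Sum>(d, j)\<in>(SIGMA d:{1..N}. {1..N div d}). h d j)"
    by (rule sum.reindex_bij_witness[of _ "\<lambda>(d, j). (d * j, d)" "\<lambda>(n, d). (d, n div d)"])
       (auto simp: less_eq_div_iff_mult_less_eq mult.commute div_le_mono dvd_div_eq_0_iff
             Suc_le_eq dvd_pos_nat intro: le_trans[OF dvd_imp_le])
  also have "\<dots> = (\<Sum>d=1..N. \<Sum>j=1..N div d. h d j)"
    by (rule sum.Sigma[symmetric]) auto
  finally show ?thesis .
qed

text \<open>Abel summation: for decreasing nonnegative weights, the last weight and the successive
  differences telescope to \<open>w 0\<close>.\<close>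

lemma summation_by_parts_bound:
  fixes F w :: "nat \<Rightarrow> real"
  assumes F: "\<And>n. \<bar>\<Sum>k<n. F k\<bar> \<le> C" and w: "\<And>k. w (Suc k) \<le> w k" "\<And>k. 0 \<le> w k"
  shows "\<bar>\<Sum>k<n. F k * w k\<bar> \<le> C * w 0"
proof -
  define A where "A n = (\<Sum>k<n. F k)" for n
  have C: "0 \<le> C" using F[of 0] by simp
  have A: "\<bar>A k\<bar> \<le> C" for k using F by (simp add: A_def)
  have "(\<Sum>k<n. F k * w k) = A n * w n + (\<Sum>k<n. A (Suc k) * (w k - w (Suc k)))"
    by (induction n) (auto simp: A_def algebra_simps)
  also have "\<bar>\<dots>\<bar> \<le> \<bar>A n * w n\<bar> + (\<Sum>k<n. \<bar>A (Suc k) * (w k - w (Suc k))\<bar>)"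
    by (rule order_trans[OF abs_triangle_ineq add_left_mono[OF sum_abs]])
  also have "\<dots> \<le> C * w n + (\<Sum>k<n. C * (w k - w (Suc k)))"
    unfolding abs_mult using A w C
    by (intro add_mono sum_mono mult_mono) auto
  also have "\<dots> = C * w 0"
    by (simp only: sum_distrib_left[symmetric] sum_lessThan_telescope') (simp add: algebra_simps)
  finally show ?thesis .
qed

text \<open>The bound is uniform in the starting point \<open>a\<close>, so the same constant
  controls the tails of the series.\<close>

definition bounded_sums :: "(nat \<Rightarrow> real) \<Rightarrow> real \<Rightarrow> bool" where
  "bounded_sums F C \<longleftrightarrow> (\<forall>a n. \<bar>\<Sum>k<n. F (a + k)\<bar> \<le> C)"

definition L_one :: "(nat \<Rightarrow> real) \<Rightarrow> real" where
  "L_one F = (\<Sum>k. F (Suc k) / Suc k)"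

lemma sum_atLeast1_lessThan: "(\<Sum>k=1..N. f k) = (\<Sum>k<N. f (Suc k))" for f :: "nat \<Rightarrow> real"
  using sum.atLeast_Suc_atMost_Suc_shift[of f 0 "N - 1"]
  by (cases N) (auto simp: sum.atLeast_Suc_atMost_Suc_shift atLeast0AtMost lessThan_Suc_atMost
    simp del: sum.cl_ivl_Suc)

lemma bounded_sums_tail:
  assumes "bounded_sums F C"
  shows "\<bar>\<Sum>k<n. F (Suc (N + k)) / Suc (N + k)\<bar> \<le> C / Suc N"
proof -
  have "\<bar>\<Sum>k<n. F (Suc N + k)\<bar> \<le> C" for n
    using assms unfolding bounded_sums_def by blast
  then have "\<bar>\<Sum>k<n. F (Suc N + k) * (1 / Suc (N + k))\<bar> \<le> C * (1 / Suc (N + 0))"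
    by (intro summation_by_parts_bound) (auto simp: frac_le)
  then show ?thesis by simp
qed

lemma bounded_sums_nonneg: "bounded_sums F C \<Longrightarrow> 0 \<le> C"
  unfolding bounded_sums_def by (drule spec, drule spec[of _ 0]) simp

text \<open>The tail bound gives the Cauchy property and, in the limit, a rate of convergence. The
  rate is what allows inner partial sums of length \<open>N div d\<close> to be replaced by
  \<open>L_one\<close> at a total cost of O(1).\<close>

lemma
  assumes "bounded_sums F C"
  shows summable_bounded_sums: "summable (\<lambda>k. F (Suc k) / Suc k)"
    and L_one_approx: "\<bar>L_one F - (\<Sum>k=1..N. F k / k)\<bar> \<le> C / Suc N"
proof -
  let ?f = "\<lambda>k. F (Suc k) / Suc k"
  have C: "0 \<le> C" by (rule bounded_sums_nonneg[OF assms])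
  have tail: "\<bar>sum ?f {m..<n}\<bar> \<le> C / Suc m" if "m \<le> n" for m n
    using bounded_sums_tail[OF assms, where N = m and n = "n - m"]
      sum.shift_bounds_nat_ivl[of ?f 0 m "n - m"] that
    by (simp add: lessThan_atLeast0 add.commute)
  show summ: "summable ?f"
    unfolding summable_Cauchy
  proof (intro allI impI)
    fix e :: real assume e: "e > 0"
    obtain N :: nat where N: "C / e < N" using reals_Archimedean2 by blast
    have "norm (sum ?f {m..<n}) < e" if "m \<ge> N" for m n
    proof (cases "m \<le> n")
      case True
      have "C < e * Suc m" using N e that by (simp add: field_simps) (smt (verit) mult_left_mono of_nat_mono)
      then have "C / Suc m < e" by (simp add: field_simps)
      then show ?thesis using tail[OF True] by simp
    qed (use e in auto)
    then show "\<exists>N. \<forall>m\<ge>N. \<forall>n. norm (sum ?f {m..<n}) < e" by blast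
  qed
  have "(\<lambda>n. \<bar>sum ?f {..<n} - sum ?f {..<N}\<bar>) \<longlonglongrightarrow> \<bar>L_one F - sum ?f {..<N}\<bar>"
    unfolding L_one_def by (intro tendsto_intros summable_LIMSEQ summ)
  moreover have "\<bar>sum ?f {..<n} - sum ?f {..<N}\<bar> \<le> C / Suc N" if "n \<ge> N" for n
    using tail[OF that] sum.atLeastLessThan_concat[of 0 N n ?f] that
    by (simp add: lessThan_atLeast0)
  ultimately have "\<bar>L_one F - sum ?f {..<N}\<bar> \<le> C / Suc N"
    by (intro LIMSEQ_le_const2) auto
  then show "\<bar>L_one F - (\<Sum>k=1..N. F k / k)\<bar> \<le> C / Suc N"
    unfolding sum_atLeast1_lessThan .
qed

section \<open>Periodic coefficients\<close>

lemma periodic_mod: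
  assumes "\<And>k::nat. f (k + M) = f k"
  shows "f (k mod M) = f k"
proof -
  have "f (k mod M + M * q) = f (k mod M)" for q
    by (induction q) (simp_all, metis assms add.assoc add.commute)
  from this[of "k div M"] show ?thesis by simp
qed

lemma periodic_cong:
  assumes "\<And>k::nat. f (k + M) = f k" "[a = b] (mod M)"
  shows "f a = f b"
  using assms(2) periodic_mod[of f M, OF assms(1)] by (metis cong_def)

lemma sum_periodic_shift:
  fixes f :: "nat \<Rightarrow> real"
  assumes "\<And>k. f (k + M) = f k"
  shows "(\<Sum>k<M. f (a + k)) = (\<Sum>k<M. f k)"
proof (induction a)
  case (Suc a)
  have "(\<Sum>k<M. f (Suc a + k)) + f a = (\<Sum>k<Suc M. f (a + k))"
    by (simp only: sum.lessThan_Suc_shift) simp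
  also have "\<dots> = (\<Sum>k<M. f (a + k)) + f a"
    using assms[of a] by simp
  finally show ?case using Suc by simp
qed simp

text \<open>Complete periods contribute zero wherever they start, so only a block shorter than
  \<open>M\<close> remains.\<close>

lemma bounded_sums_periodic:
  assumes per: "\<And>k. F (k + M) = F k" and zero: "(\<Sum>k<M. F k) = 0" and M: "M > 0"
  shows "bounded_sums F (\<Sum>k<M. \<bar>F k\<bar>)"
  unfolding bounded_sums_def
proof (intro allI)
  fix a n
  show "\<bar>\<Sum>k<n. F (a + k)\<bar> \<le> (\<Sum>k<M. \<bar>F k\<bar>)"
  proof (induction n arbitrary: a rule: less_induct)
    case (less n)
    show ?case
    proof (cases "n < M")
      case True
      have "\<bar>\<Sum>k<n. F (a + k)\<bar> \<le> (\<Sum>k<n. \<bar>F (a + k)\<bar>)" by (rule sum_abs)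
      also have "\<dots> \<le> (\<Sum>k<M. \<bar>F (a + k)\<bar>)"
        using True by (intro sum_mono2) auto
      also have "\<dots> = (\<Sum>k<M. \<bar>F k\<bar>)"
        by (rule sum_periodic_shift[of "\<lambda>k. \<bar>F k\<bar>"]) (simp add: per)
      finally show ?thesis .
    next
      case False
      then obtain q where q: "n = M + q" using le_Suc_ex not_less by blast
      have "(\<Sum>k<n. F (a + k)) = (\<Sum>k<M. F (a + k)) + (\<Sum>k<q. F (a + M + k))"
        unfolding q lessThan_atLeast0 using sum.atLeastLessThan_concat[of 0 M "M + q" "\<lambda>k. F (a + k)"]
          sum.shift_bounds_nat_ivl[of "\<lambda>k. F (a + k)" 0 M q]
        by (simp add: add_ac)
      also have "(\<Sum>k<M. F (a + k)) = 0"
        using sum_periodic_shift[of F M a, OF per] zero by simp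
      finally show ?thesis using less.IH[of q "a + M"] q M by simp
    qed
  qed
qed

section \<open>The Moebius and von Mangoldt functions\<close>

definition moebius_mu :: "nat \<Rightarrow> real" where
  "moebius_mu n = (if squarefree n then (- 1) ^ card (prime_factors n) else 0)"

lemma abs_moebius_mu_le: "\<bar>moebius_mu n\<bar> \<le> 1"
  by (simp add: moebius_mu_def power_abs)

lemma moebius_mu_prime_mult:
  assumes "prime p" "\<not> p dvd d" "squarefree d"
  shows "moebius_mu (p * d) = - moebius_mu d"
proof -
  have cop: "coprime p d" using assms prime_imp_coprime by blast
  have "squarefree (p * d)"
    by (rule squarefree_mult_coprime) (use assms cop in \<open>auto intro: squarefree_prime\<close>)
  moreover have "prime_factors (p * d) = insert p (prime_factors d)"
    using assms not_squarefree_0[where ?'a = nat]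
    by (subst prime_factors_product) (auto simp: prime_factorization_prime intro!: Nat.gr0I)
  moreover have "p \<notin> prime_factors d" using assms by auto
  ultimately show ?thesis using assms by (simp add: moebius_mu_def)
qed

text \<open>For a fixed prime \<open>p\<close> dividing \<open>n\<close>, the squarefree divisors
  \<open>d\<close> prime to \<open>p\<close> pair with \<open>p * d\<close>, and the two terms
  cancel.\<close>

lemma sum_moebius_mu:
  assumes "n > 0"
  shows "(\<Sum>d | d dvd n. moebius_mu d) = (if n = 1 then 1 else 0)"
proof (cases "n = 1")
  case True
  then show ?thesis by (simp add: moebius_mu_def)
next
  case False
  then obtain p where p: "prime p" "p dvd n" using prime_factor_nat by blast
  let ?A = "{d. d dvd n \<and> squarefree d \<and> \<not> p dvd d}"
  let ?B = "{d. d dvd n \<and> squarefree d \<and> p dvd d}"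
  have fin: "finite {d. d dvd n}" using assms by simp
  have "(\<Sum>d | d dvd n. moebius_mu d) = (\<Sum>d\<in>?A \<union> ?B. moebius_mu d)"
    using fin by (intro sum.mono_neutral_right) (auto simp: moebius_mu_def)
  also have "\<dots> = (\<Sum>d\<in>?A. moebius_mu d) + (\<Sum>d\<in>?B. moebius_mu d)"
    by (rule sum.union_disjoint) (auto intro: finite_subset[OF _ fin])
  also have "(\<Sum>d\<in>?B. moebius_mu d) = (\<Sum>d\<in>?A. - moebius_mu d)"
  proof (rule sum.reindex_bij_witness[of _ "\<lambda>d. p * d" "\<lambda>d. d div p"])
    fix d assume d: "d \<in> ?B"
    then obtain k where k: "d = p * k" by (auto elim: dvdE)
    have np: "\<not> p dvd k"
    proof
      assume "p dvd k"
      then have "p ^ 2 dvd d" by (auto simp: k power2_eq_square)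
      then show False using d p(1) squarefreeD[of d p] by simp
    qed
    have kk: "squarefree k" "k dvd n" using d k squarefree_mono[of k d] dvd_trans[of k d n] by auto
    show "p * (d div p) = d" using k p by simp
    show "d div p \<in> ?A" using k p np kk by simp
    show "- moebius_mu (d div p) = moebius_mu d"
      using k p np kk moebius_mu_prime_mult[of p k] by simp
  next
    fix d assume d: "d \<in> ?A"
    then have cop: "coprime p d" using p prime_imp_coprime by blast
    show "p * d div p = d" using p by simp
    show "p * d \<in> ?B"
      using d p cop squarefree_mult_coprime[of p d] squarefree_prime[of p]
      by (auto intro!: divides_mult)
  qed
  finally show ?thesis using False by (simp add: sum_negf)
qed

text \<open>Expanding \<open>ln (n / d)\<close> as a sum of \<open>mangoldt e\<close> over
  \<open>e dvd n div d\<close> and exchanging the sums leaves only \<open>e = n\<close>, since the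
  inner Moebius sum vanishes otherwise.\<close>

lemma sum_moebius_mu_ln:
  assumes n: "n > 0"
  shows "(\<Sum>d | d dvd n. moebius_mu d * ln (real d)) = - mangoldt n"
proof -
  have fin: "finite {d. d dvd n}" "finite {e. e dvd n div d}" if "d dvd n" for d
    using n that by (auto simp: dvd_div_eq_0_iff)
  have "(\<Sum>d | d dvd n. moebius_mu d * (ln (real n) - ln (real d)))
      = (\<Sum>d | d dvd n. \<Sum>e | e dvd n div d. moebius_mu d * mangoldt e)"
  proof (intro sum.cong refl)
    fix d assume "d \<in> {d. d dvd n}"
    then have d: "d dvd n" "d > 0" "n div d > 0"
      using n by (auto simp: dvd_div_eq_0_iff intro: dvd_pos_nat)
    have "real n / real d = real (n div d)" using d by (simp add: real_of_nat_div)
    then have "ln (real n) - ln (real d) = ln (real (n div d))"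
      using n d ln_divide_pos[of "real n" "real d"] by simp
    then show "moebius_mu d * (ln (real n) - ln (real d))
        = (\<Sum>e | e dvd n div d. moebius_mu d * mangoldt e)"
      using d mangoldt_sum[of "n div d", where ?'a = real] by (simp add: sum_distrib_left[symmetric])
  qed
  also have "\<dots> = (\<Sum>(d, e)\<in>(SIGMA d:{d. d dvd n}. {e. e dvd n div d}). moebius_mu d * mangoldt e)"
    using fin by (intro sum.Sigma) auto
  also have "\<dots> = (\<Sum>(e, d)\<in>(SIGMA e:{e. e dvd n}. {d. d dvd n div e}). moebius_mu d * mangoldt e)"
  proof (rule sum.reindex_bij_witness[of _ prod.swap prod.swap])
    have sw: "d dvd n \<and> e dvd n div d \<longleftrightarrow> e dvd n \<and> d dvd n div e" for d e
    proof -
      have "d dvd n \<and> e dvd n div d \<longleftrightarrow> d * e dvd n" for d e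
      proof (cases "d = 0")
        case False
        then show ?thesis using dvd_div_iff_mult[of d n e] dvd_mult_left[of d e n]
          by (auto simp: mult.commute)
      qed (use n in auto)
      from this[of d e] this[of e d] show ?thesis by (simp add: mult.commute)
    qed
    show "prod.swap a \<in> (SIGMA e:{e. e dvd n}. {d. d dvd n div e})"
      if "a \<in> (SIGMA d:{d. d dvd n}. {e. e dvd n div d})" for a
      using that sw by (cases a) auto
    show "prod.swap a \<in> (SIGMA d:{d. d dvd n}. {e. e dvd n div d})"
      if "a \<in> (SIGMA d:{d. d dvd n}. {e. e dvd n div d})" for a
      using that sw by (cases a) auto
  qed (auto simp: split_beta)
  also have "\<dots> = (\<Sum>e | e dvd n. \<Sum>d | d dvd n div e. moebius_mu d * mangoldt e)"
    using fin by (intro sum.Sigma[symmetric]) auto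
  also have "\<dots> = (\<Sum>e | e dvd n. if e = n then mangoldt n else 0)"
  proof (intro sum.cong refl)
    fix e assume "e \<in> {d. d dvd n}"
    then have e: "e dvd n" "n div e > 0" "n div e = 1 \<longleftrightarrow> e = n"
      using n by (auto simp: dvd_div_eq_0_iff dvd_div_eq_mult)
    show "(\<Sum>d | d dvd n div e. moebius_mu d * mangoldt e) = (if e = n then mangoldt n else 0)"
      using sum_moebius_mu[OF e(2)] e by (simp add: sum_distrib_right[symmetric])
  qed
  also have "\<dots> = mangoldt n" using n by simp
  finally have "ln (real n) * (\<Sum>d | d dvd n. moebius_mu d)
      - (\<Sum>d | d dvd n. moebius_mu d * ln (real d)) = mangoldt n"
    by (simp add: sum_subtractf sum_distrib_left algebra_simps)
  \<comment> \<open>For \<open>n = 1\<close> the logarithm is zero, and for larger \<open>n\<close>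
    the divisor sum is.\<close>
  moreover have "ln (real n) * (\<Sum>d | d dvd n. moebius_mu d) = 0"
    using sum_moebius_mu[OF n] by simp
  ultimately show ?thesis by simp
qed

section \<open>Legendre's formula, Chebyshev's bound and Mertens' estimates\<close>

lemma ln_fact_eq_sum_mangoldt:
  "ln (fact N) = (\<Sum>d=1..N. mangoldt d * real (N div d))"
proof -
  have "ln (fact N :: real) = (\<Sum>n=1..N. ln (real n))"
    by (induction N) (simp_all add: ln_mult_pos)
  also have "\<dots> = (\<Sum>n=1..N. \<Sum>d | d dvd n. mangoldt d)"
    by (intro sum.cong refl) (simp add: mangoldt_sum)
  also have "\<dots> = (\<Sum>d=1..N. \<Sum>j=1..N div d. mangoldt d)"
    by (rule sum_divisors_swap[where h = "\<lambda>d j. mangoldt d"])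
  finally show ?thesis by (simp add: mult.commute)
qed

lemma ln_fact_upper: "ln (fact N) \<le> real N * ln N"
proof (cases "N = 0")
  case False
  have "ln (fact N :: real) \<le> ln (real (N ^ N))"
    using fact_le_power[of N, where ?'a = real] False by (subst ln_le_cancel_iff) auto
  then show ?thesis using False by (simp add: ln_realpow)
qed simp

lemma ln_fact_lower: "real N * ln N - N \<le> ln (fact N)"
proof (induction N)
  case (Suc N)
  show ?case
  proof (cases "N = 0")
    case False
    have "ln (1 + 1 / real N) \<le> 1 / real N" using False by (intro ln_add_one_self_le_self) auto
    moreover have "ln (1 + 1 / real N) = ln (Suc N) - ln N"
    proof -
      have "1 + 1 / real N = real (Suc N) / real N" using False by (simp add: field_simps)
      then show ?thesis using False by (simp add: ln_divide_pos)
    qed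
    ultimately have "real N * (ln (Suc N) - ln N) \<le> real N * (1 / real N)"
      by (intro mult_left_mono) simp_all
    then have "real N * (ln (Suc N) - ln N) \<le> 1" using False by simp
    moreover have "ln (fact (Suc N) :: real) = ln (Suc N) + ln (fact N)"
      by (simp add: ln_mult_pos)
    ultimately show ?thesis using Suc by (simp add: algebra_simps)
  qed simp
qed simp

text \<open>The coefficient \<open>2 * n div d - 2 * (n div d)\<close> in Legendre's formula for the
  central binomial coefficient is nonnegative and equals 1 for \<open>n < d \<le> 2 * n\<close>. The
  binomial coefficient itself is at most \<open>2 ^ (2 * n)\<close>.\<close>

lemma chebyshev_psi_double:
  "(\<Sum>d=1..2*n. mangoldt d) \<le> (\<Sum>d=1..n. mangoldt d) + 2 * real n"
proof -
  have "(\<Sum>d=1..2*n. mangoldt d) - (\<Sum>d=1..n. mangoldt d :: real) = (\<Sum>d=n+1..2*n. mangoldt d)"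
    using sum.ub_add_nat[of 1 n "\<lambda>d. mangoldt d :: real" n] by (simp add: mult_2)
  also have "\<dots> = (\<Sum>d=1..2*n. if d > n then mangoldt d else 0)"
    by (rule sum.mono_neutral_cong_left) auto
  also have "\<dots> \<le> (\<Sum>d=1..2*n. mangoldt d * (real (2 * n div d) - 2 * real (n div d)))"
  proof (rule sum_mono)
    fix d assume d: "d \<in> {1..2*n}"
    have "2 * (n div d) * d \<le> 2 * n" using div_times_less_eq_dividend[of n d] by simp
    then have "2 * (n div d) \<le> 2 * n div d" using d by (simp add: less_eq_div_iff_mult_less_eq)
    then have ge: "0 \<le> real (2 * n div d) - 2 * real (n div d)" by linarith
    show "(if d > n then mangoldt d else 0)
        \<le> mangoldt d * (real (2 * n div d) - 2 * real (n div d))"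
    proof (cases "d > n")
      case True
      then have "2 * n div d = 1" using d by (intro div_nat_eqI) auto
      then show ?thesis using True by simp
    qed (use ge mangoldt_nonneg in auto)
  qed
  also have "\<dots> = ln (fact (2 * n)) - 2 * (\<Sum>d=1..2*n. mangoldt d * real (n div d))"
    by (simp add: ln_fact_eq_sum_mangoldt sum_subtractf sum_distrib_left algebra_simps)
  also have "(\<Sum>d=1..2*n. mangoldt d * real (n div d)) = ln (fact n)"
    unfolding ln_fact_eq_sum_mangoldt by (rule sum.mono_neutral_right) auto
  also have "ln (fact (2 * n)) - 2 * ln (fact n :: real) = ln (real (2 * n choose n))"
  proof -
    have "real (2 * n choose n) = fact (2 * n) / (fact n * fact n)"
      using binomial_fact[of n "2 * n", where ?'a = real] by simp
    then have "ln (real (2 * n choose n)) = ln (fact (2 * n)) - ln (fact n * fact n :: real)"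
      by (simp only: ln_divide_pos fact_gt_zero mult_pos_pos)
    also have "ln (fact n * fact n :: real) = ln (fact n) + ln (fact n)"
      by (intro ln_mult_pos) simp_all
    finally show ?thesis by simp
  qed
  also have "\<dots> \<le> ln (2 ^ (2 * n))"
  proof -
    have "real (2 * n choose n) \<le> real (2 ^ (2 * n))"
      unfolding of_nat_le_iff by (rule binomial_le_pow2)
    then show ?thesis by simp
  qed
  also have "\<dots> = 2 * real n * ln 2" by (simp add: ln_realpow)
  also have "\<dots> \<le> 2 * real n" using ln_2_less_1 by (simp add: mult_left_le)
  finally show ?thesis by simp
qed

lemma chebyshev_psi_le: "(\<Sum>d=1..N. mangoldt d) \<le> 4 * real N"
proof (induction N rule: less_induct)
  case (less N)
  consider "N \<le> 1" | n where "N = 2 * n" "n > 0" | n where "N = 2 * n + 1" "n > 0"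
    by (metis One_nat_def add.commute bot_nat_0.not_eq_extremum le_eq_less_or_eq mult_0_right oddE evenE
        plus_1_eq_Suc less_Suc0 zero_le)
  then show ?case
  proof cases
    case 1
    then have "N = 0 \<or> N = 1" by auto
    then show ?thesis by auto
  next
    case (2 n)
    then show ?thesis using less.IH[of n] chebyshev_psi_double[of n] by simp
  next
    case (3 n)
    \<comment> \<open>For odd \<open>N\<close> the sum is enlarged to the next even number; the
      resulting bound \<open>6 * (n + 1)\<close> is at most \<open>4 * (2 * n + 1)\<close> because
      \<open>n \<ge> 1\<close>.\<close>
    have "(\<Sum>d=1..N. mangoldt d) \<le> (\<Sum>d=1..2*(n+1). mangoldt d :: real)"
      using 3 by (intro sum_mono2) (auto intro: mangoldt_nonneg)
    then show ?thesis using less.IH[of "n + 1"] chebyshev_psi_double[of "n + 1"] 3 by simp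
  qed
qed

lemma mertens_lower:
  assumes "N > 0"
  shows "ln (real N) - 1 \<le> (\<Sum>d=1..N. mangoldt d / real d)"
proof -
  have "real N * ln N - N \<le> (\<Sum>d=1..N. mangoldt d * real (N div d))"
    using ln_fact_lower[of N] by (simp add: ln_fact_eq_sum_mangoldt)
  also have "\<dots> \<le> (\<Sum>d=1..N. real N * (mangoldt d / real d))"
  proof (rule sum_mono)
    fix d assume "d \<in> {1..N}"
    then have "mangoldt d * real (N div d) \<le> mangoldt d * (real N / real d)"
      by (intro mult_left_mono mangoldt_nonneg of_nat_div_le_of_nat)
    then show "mangoldt d * real (N div d) \<le> real N * (mangoldt d / real d)"
      by (simp add: field_simps)
  qed
  also have "\<dots> = real N * (\<Sum>d=1..N. mangoldt d / real d)" by (simp add: sum_distrib_left)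
  finally have "real N * (ln (real N) - 1) \<le> real N * (\<Sum>d=1..N. mangoldt d / real d)"
    by (simp add: algebra_simps)
  then show ?thesis using assms by simp
qed

text \<open>\<open>N / d\<close> exceeds \<open>N div d\<close> by less than 1, so the error made in
  Legendre's formula is at most the Chebyshev sum.\<close>

lemma mertens_upper:
  assumes "N > 0"
  shows "(\<Sum>d=1..N. mangoldt d / real d) \<le> ln (real N) + 4"
proof -
  have "real N * (\<Sum>d=1..N. mangoldt d / real d) = (\<Sum>d=1..N. mangoldt d * (real N / real d))"
    by (simp add: sum_distrib_left algebra_simps)
  also have "\<dots> \<le> (\<Sum>d=1..N. mangoldt d * (real (N div d) + 1))"
  proof (intro sum_mono mult_left_mono mangoldt_nonneg)
    fix d assume "d \<in> {1..N}"
    then show "real N / real d \<le> real (N div d) + 1"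
      by (simp add: of_nat_of_nat_div_aux[of N d] less_imp_le)
  qed
  also have "\<dots> = ln (fact N) + (\<Sum>d=1..N. mangoldt d)"
    by (simp add: ln_fact_eq_sum_mangoldt sum.distrib algebra_simps)
  also have "\<dots> \<le> real N * (ln N + 4)"
    using ln_fact_upper[of N] chebyshev_psi_le[of N] by (simp add: algebra_simps)
  finally show ?thesis using assms by simp
qed

section \<open>Logarithmic means over primes\<close>

lemma bounded_imp_bigo_1: "(\<And>N. N > 0 \<Longrightarrow> \<bar>f N\<bar> \<le> K) \<Longrightarrow> f \<in> O(\<lambda>_::nat. 1::real)"
  by (intro bigoI[of _ K] eventually_mono[OF eventually_gt_at_top[of 0]]) auto

text \<open>This is how the estimates modulo O(1) are exploited: two of them can be compared only if
  their coefficients of \<open>ln N\<close> agree.\<close>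

lemma ln_not_bigo_1: "(\<lambda>N::nat. c * ln (real N)) \<in> O(\<lambda>_. 1::real) \<Longrightarrow> c = 0"
proof (rule ccontr)
  assume "(\<lambda>N::nat. c * ln (real N)) \<in> O(\<lambda>_. 1::real)" "c \<noteq> 0"
  then have "(\<lambda>N::nat. ln (real N)) \<in> O(\<lambda>_. 1::real)" by simp
  then obtain K where K: "\<forall>\<^sub>F N::nat in at_top. norm (ln (real N)) \<le> K * norm (1::real)"
    by (auto elim: landau_o.bigE)
  have "filterlim (\<lambda>N::nat. ln (real N)) at_top at_top"
    by (intro filterlim_compose[OF ln_at_top filterlim_real_sequentially])
  then have "\<forall>\<^sub>F N::nat in at_top. ln (real N) > K" by (simp add: filterlim_at_top_dense)
  with K have "\<forall>\<^sub>F N::nat in at_top. False" by eventually_elim auto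
  then show False by simp
qed

lemma bigo_1_mono:
  assumes "g \<in> O(\<lambda>_::nat. 1::real)" "\<And>N. N > 0 \<Longrightarrow> 0 \<le> f N" "\<And>N. N > 0 \<Longrightarrow> f N \<le> g N"
  shows "f \<in> O(\<lambda>_::nat. 1::real)"
proof (rule landau_o.big.trans[OF _ assms(1)])
  have "norm (f N) \<le> 1 * norm (g N)" if "N > 0" for N
    using assms(2,3)[OF that] by simp
  then show "f \<in> O(g)"
    by (intro bigoI[of _ 1] eventually_mono[OF eventually_gt_at_top[of 0]])
qed

lemma divide_Suc_div_le:
  assumes "(0::real) \<le> C" "N > 0" "d > 0"
  shows "C / Suc (N div d) \<le> C * d / N"
proof -
  have "real N / real d \<le> Suc (N div d)"
    using assms by (simp add: of_nat_of_nat_div_aux[of N d] less_imp_le)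
  then have "C / Suc (N div d) \<le> C / (real N / real d)"
    using assms by (intro divide_left_mono) auto
  then show ?thesis by simp
qed

text \<open>Abel summation with the weight \<open>ln x / x\<close>. That weight decreases only from
  \<open>exp 1\<close> on, so the summation starts at 3; the term at 1 is zero and the term at 2 is
  kept apart.\<close>

lemma sum_ln_over_bigo_1:
  assumes F: "bounded_sums F C"
  shows "(\<lambda>N. \<Sum>n=1..N. F n / n * ln (real n)) \<in> O(\<lambda>_::nat. 1::real)"
proof -
  let ?t = "\<lambda>n. F n / n * ln (real n)"
  let ?w = "\<lambda>k. ln (3 + real k) / (3 + real k)"
  have C: "0 \<le> C" by (rule bounded_sums_nonneg[OF F])
  have dec: "?w (Suc k) \<le> ?w k" for k
  proof -
    define x where "x = 3 + real k"
    have x: "x \<ge> 3" by (simp add: x_def)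
    have "1 \<le> ln (3 :: real)" using exp_le by (subst ln_ge_iff) auto
    then have 1: "1 \<le> ln x" using x by (smt (verit) ln_le_cancel_iff)
    have "ln (x + 1) = ln x + ln (1 + 1 / x)"
    proof -
      have "x + 1 = x * (1 + 1 / x)" using x by (simp add: field_simps)
      then show ?thesis using x ln_mult_pos[of x "1 + 1 / x"] by (simp add: add_pos_pos)
    qed
    also have "ln (1 + 1 / x) \<le> 1 / x" using x by (intro ln_add_one_self_le_self) auto
    finally have "x * ln (x + 1) \<le> x * ln x + 1" using x by (simp add: field_simps)
    then have "x * ln (x + 1) \<le> (x + 1) * ln x" using 1 by (simp add: algebra_simps)
    then have "ln (x + 1) / (x + 1) \<le> ln x / x" using x by (simp add: field_simps)
    then show ?thesis by (simp add: x_def add_ac)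
  qed
  have "\<bar>\<Sum>k<n. F (3 + k)\<bar> \<le> C" for n using F unfolding bounded_sums_def by blast
  then have b: "\<bar>\<Sum>k<n. F (3 + k) * ?w k\<bar> \<le> C * ?w 0" for n
    using dec by (intro summation_by_parts_bound) auto
  have "\<bar>\<Sum>n=1..N. ?t n\<bar> \<le> \<bar>?t 2\<bar> + C * ?w 0" for N
  proof (cases "N < 2")
    case True
    then have "N = 0 \<or> N = 1" by auto
    then show ?thesis using C by auto
  next
    case False
    then obtain n where n: "N = 2 + n" using le_Suc_ex not_less by blast
    have "(\<Sum>n=1..N. ?t n) = (\<Sum>k<2 + n. ?t (Suc k))"
      unfolding n by (rule sum_atLeast1_lessThan)
    also have "\<dots> = ?t 2 + (\<Sum>k<n. F (3 + k) * ?w k)"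
      by (induction n) (simp_all add: numeral_2_eq_2 numeral_3_eq_3 add_ac)
    finally show ?thesis using b[of n] by linarith
  qed
  then show ?thesis by (intro bounded_imp_bigo_1)
qed

text \<open>Both estimates come from \<open>\<Sum>\<^bsub>d\<le>N\<^esub> a d / d * (\<Sum>\<^bsub>j\<le>N/d\<^esub> F (d j) / j)\<close>, the first with the von
  Mangoldt function and the second with \<open>\<mu> d * ln (N / d)\<close> in place of \<open>a d\<close>.\<close>

lemma sum_mangoldt_L_one_bigo_1:
  assumes F: "\<And>d. bounded_sums (\<lambda>k. F (d * k)) C"
  shows "(\<lambda>N. \<Sum>d=1..N. mangoldt d / d * L_one (\<lambda>k. F (d * k))) \<in> O(\<lambda>_::nat. 1::real)"
proof -
  have C: "0 \<le> C" by (rule bounded_sums_nonneg[OF F])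
  define G where "G N = (\<Sum>d=1..N. mangoldt d / d * (\<Sum>j=1..N div d. F (d * j) / j))" for N
  have "G N = (\<Sum>n=1..N. F n / n * ln (real n))" for N
  proof -
    have "G N = (\<Sum>d=1..N. \<Sum>j=1..N div d. mangoldt d / d * (F (d * j) / j))"
      by (simp add: G_def sum_distrib_left)
    also have "\<dots> = (\<Sum>n=1..N. \<Sum>d | d dvd n. mangoldt d / d * (F (d * (n div d)) / real (n div d)))"
      by (rule sum_divisors_swap[symmetric])
    also have "\<dots> = (\<Sum>n=1..N. \<Sum>d | d dvd n. F n / n * mangoldt d)"
      by (intro sum.cong refl) (auto simp: real_of_nat_div)
    also have "\<dots> = (\<Sum>n=1..N. F n / n * ln (real n))"
      by (intro sum.cong refl) (subst sum_distrib_left[symmetric], simp add: mangoldt_sum)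
    finally show ?thesis .
  qed
  then have "G = (\<lambda>N. \<Sum>n=1..N. F n / n * ln (real n))" by (rule ext)
  then have G: "G \<in> O(\<lambda>_. 1)"
    using sum_ln_over_bigo_1[of F C] F[of 1] by (simp only: mult_1)
  have "(\<lambda>N. (\<Sum>d=1..N. mangoldt d / d * L_one (\<lambda>k. F (d * k))) - G N) \<in> O(\<lambda>_::nat. 1::real)"
  proof (rule bounded_imp_bigo_1)
    fix N :: nat assume N: "N > 0"
    have "\<bar>(\<Sum>d=1..N. mangoldt d / d * L_one (\<lambda>k. F (d * k))) - G N\<bar>
       \<le> (\<Sum>d=1..N. mangoldt d / d * \<bar>L_one (\<lambda>k. F (d * k)) - (\<Sum>j=1..N div d. F (d * j) / j)\<bar>)"
      unfolding G_def sum_subtractf[symmetric] right_diff_distrib[symmetric]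
      by (rule order_trans[OF sum_abs]) (simp add: abs_mult)
    \<comment> \<open>The tail error grows linearly in \<open>d\<close> and cancels the weight
      \<open>1 / d\<close>; what is left is the Chebyshev sum divided by \<open>N\<close>.\<close>
    also have "\<dots> \<le> (\<Sum>d=1..N. mangoldt d / d * (C * d / N))"
    proof (intro sum_mono mult_left_mono)
      fix d assume d: "d \<in> {1..N}"
      have "\<bar>L_one (\<lambda>k. F (d * k)) - (\<Sum>j=1..N div d. F (d * j) / j)\<bar> \<le> C / Suc (N div d)"
        by (rule L_one_approx[OF F])
      also have "\<dots> \<le> C * d / N" using C N d by (intro divide_Suc_div_le) auto
      finally show "\<bar>L_one (\<lambda>k. F (d * k)) - (\<Sum>j=1..N div d. F (d * j) / j)\<bar> \<le> C * d / N" by simp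
    qed (auto intro: divide_nonneg_nonneg mangoldt_nonneg)
    also have "\<dots> = C / N * (\<Sum>d=1..N. mangoldt d)"
      by (simp add: sum_distrib_left mult.commute)
    also have "\<dots> \<le> C / N * (4 * N)"
      using C chebyshev_psi_le[of N] by (intro mult_left_mono) auto
    finally show "\<bar>(\<Sum>d=1..N. mangoldt d / d * L_one (\<lambda>k. F (d * k))) - G N\<bar> \<le> 4 * C"
      using N by simp
  qed
  from sum_in_bigo(1)[OF this G] show ?thesis by simp
qed

lemma sum_mangoldt_of_L_one_zero:
  assumes F: "\<And>d. bounded_sums (\<lambda>k. F (d * k)) C"
    and zero: "\<And>d. d > 0 \<Longrightarrow> L_one (\<lambda>k. F (d * k)) = 0"
  shows "(\<lambda>N. (\<Sum>d=1..N. mangoldt d / d * F d) + F 1 * ln (real N)) \<in> O(\<lambda>_::nat. 1::real)"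
proof (rule bounded_imp_bigo_1)
  fix N :: nat assume N: "N > 0"
  have C: "0 \<le> C" by (rule bounded_sums_nonneg[OF F])
  let ?a = "\<lambda>d::nat. moebius_mu d * (ln (real N) - ln (real d))"
  have "(\<Sum>d=1..N. ?a d / d * (\<Sum>j=1..N div d. F (d * j) / j))
      = (\<Sum>d=1..N. \<Sum>j=1..N div d. ?a d / d * (F (d * j) / j))"
    by (simp add: sum_distrib_left)
  also have "\<dots> = (\<Sum>n=1..N. \<Sum>d | d dvd n. ?a d / d * (F (d * (n div d)) / real (n div d)))"
    by (rule sum_divisors_swap[symmetric])
  also have "\<dots> = (\<Sum>n=1..N. \<Sum>d | d dvd n. F n / n * ?a d)"
    by (intro sum.cong refl) (auto simp: real_of_nat_div)
  \<comment> \<open>The divisor sum of \<open>moebius_mu d * ln (N / d)\<close> is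
    \<open>mangoldt n\<close>, with the extra term \<open>ln N\<close> at \<open>n = 1\<close>. That
    extra term produces \<open>F 1 * ln N\<close>.\<close>
  also have "\<dots> = (\<Sum>n=1..N. F n / n * ((if n = 1 then ln (real N) else 0) + mangoldt n))"
  proof (intro sum.cong refl)
    fix n assume n: "n \<in> {1..N}"
    have "(\<Sum>d | d dvd n. ?a d) = ln (real N) * (\<Sum>d | d dvd n. moebius_mu d)
        - (\<Sum>d | d dvd n. moebius_mu d * ln (real d))"
      by (simp add: sum_distrib_left sum_subtractf algebra_simps)
    also have "\<dots> = (if n = 1 then ln (real N) else 0) + mangoldt n"
      using n by (simp add: sum_moebius_mu sum_moebius_mu_ln)
    finally show "(\<Sum>d | d dvd n. F n / n * ?a d)
        = F n / n * ((if n = 1 then ln (real N) else 0) + mangoldt n)"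
      by (simp only: sum_distrib_left[symmetric])
  qed
  also have "\<dots> = (\<Sum>n=1..N. F n / n * (if n = 1 then ln (real N) else 0)) + (\<Sum>n=1..N. mangoldt n / n * F n)"
    by (simp add: sum.distrib distrib_left mult.commute)
  also have "(\<Sum>n=1..N. F n / n * (if n = 1 then ln (real N) else 0)) = (\<Sum>n=1..N. if n = 1 then F 1 * ln (real N) else 0)"
    by (intro sum.cong) auto
  also have "\<dots> = F 1 * ln (real N)"
    using N by simp
  finally have eq: "(\<Sum>d=1..N. mangoldt d / d * F d) + F 1 * ln (real N)
      = (\<Sum>d=1..N. ?a d / d * (\<Sum>j=1..N div d. F (d * j) / j))" by simp
  have "\<bar>(\<Sum>d=1..N. ?a d / d * (\<Sum>j=1..N div d. F (d * j) / j))\<bar>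
      \<le> (\<Sum>d=1..N. \<bar>?a d / d\<bar> * \<bar>\<Sum>j=1..N div d. F (d * j) / j\<bar>)"
    by (rule order_trans[OF sum_abs]) (simp add: abs_mult)
  also have "\<dots> \<le> (\<Sum>d=1..N. ((ln N - ln d) / d) * (C * d / N))"
  proof (intro sum_mono mult_mono)
    fix d assume d: "d \<in> {1..N}"
    have ln: "ln d \<le> ln N" using d by simp
    have "\<bar>moebius_mu d\<bar> * \<bar>ln N - ln d\<bar> \<le> 1 * (ln N - ln d)"
      using abs_moebius_mu_le ln by (intro mult_mono) auto
    then show "\<bar>?a d / d\<bar> \<le> (ln N - ln d) / d"
      using d by (simp add: abs_mult divide_right_mono)
    show "0 \<le> (ln N - ln d) / d" using ln by simp
    have "\<bar>L_one (\<lambda>k. F (d * k)) - (\<Sum>j=1..N div d. F (d * j) / j)\<bar> \<le> C / Suc (N div d)"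
      by (rule L_one_approx[OF F])
    also have "\<dots> \<le> C * d / N" using C N d by (intro divide_Suc_div_le) auto
    \<comment> \<open>Since the value of \<open>L_one\<close> is zero, the inner partial sum is
      nothing but the tail error.\<close>
    finally show "\<bar>\<Sum>j=1..N div d. F (d * j) / j\<bar> \<le> C * d / N" using d zero[of d] by simp
  qed auto
  also have "\<dots> = (\<Sum>d=1..N. C / N * (ln N - ln d))"
    by (intro sum.cong) auto
  also have "\<dots> = C / N * (N * ln N - (\<Sum>d=1..N. ln d))"
    by (simp only: sum_distrib_left[symmetric] sum_subtractf) simp
  also have "(\<Sum>d=1..N. ln d) = ln (fact N)"
    by (induction N) (simp_all add: ln_mult_pos)
  \<comment> \<open>The lower bound for \<open>ln (fact N)\<close> cancels the main term
    \<open>N * ln N\<close>, so no logarithm survives.\<close>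
  also have "C / N * (N * ln N - ln (fact N)) \<le> C / N * N"
    using ln_fact_lower[of N] C by (intro mult_left_mono) auto
  also have "\<dots> = C" using N by simp
  finally show "\<bar>(\<Sum>d=1..N. mangoldt d / d * F d) + F 1 * ln (real N)\<bar> \<le> C"
    unfolding eq .
qed

section \<open>Real characters\<close>

lemma prime_power_mult_induct [consumes 1, case_names one step]:
  fixes n :: nat
  assumes "n > 0" "P 1"
    and "\<And>p k m. prime p \<Longrightarrow> \<not> p dvd m \<Longrightarrow> m > 0 \<Longrightarrow> P m \<Longrightarrow> P (p ^ k * m)"
  shows "P n"
  using assms(1)
proof (induction n rule: less_induct)
  case (less n)
  show ?case
  proof (cases "n = 1")
    case False
    then obtain p where p: "prime p" "p dvd n" using prime_factor_nat by blast
    then obtain m where m: "n = p ^ multiplicity p n * m" "\<not> p dvd m"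
      using multiplicity_decompose'[of n p] less.prems not_prime_unit by blast
    have "multiplicity p n > 0" using p less.prems by (simp add: prime_multiplicity_gt_zero_iff)
    then have "1 < p ^ multiplicity p n" using p by (intro one_less_power prime_gt_1_nat) auto
    moreover have "m > 0" using m less.prems by (intro Nat.gr0I) auto
    ultimately have "1 * m < p ^ multiplicity p n * m" by (intro mult_strict_right_mono) auto
    then have "m < n" using m(1) by simp
    then have "P (p ^ multiplicity p n * m)"
      using assms(3) m p less.IH \<open>m > 0\<close> by blast
    then show ?thesis using m(1) by simp
  qed (use assms(2) in simp)
qed

text \<open>A divisor of \<open>a * b\<close> factors uniquely as \<open>x * y\<close>, and its gcds
  with \<open>a\<close> and \<open>b\<close> recover the factors.\<close>

lemma sum_divisors_coprime_mult:
  fixes f :: "nat \<Rightarrow> real"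
  assumes "coprime a b" "a > 0" "b > 0" and mult: "\<And>x y. f (x * y) = f x * f y"
  shows "(\<Sum>d | d dvd a * b. f d) = (\<Sum>d | d dvd a. f d) * (\<Sum>d | d dvd b. f d)"
proof -
  have gcd_eq: "gcd (x * y) a = x" if "x dvd a" "y dvd b" "coprime a b" for x y a b :: nat
  proof (rule dvd_antisym)
    have "coprime (gcd (x * y) a) y"
      using that by (meson coprime_divisors gcd_dvd2)
    then show "gcd (x * y) a dvd x"
      using gcd_dvd1[of "x * y" a] by (simp only: coprime_dvd_mult_left_iff)
  qed (use that in auto)
  have 1: "gcd (x * y) a = x" "gcd (x * y) b = y" if "x dvd a" "y dvd b" for x y
    using gcd_eq[OF that assms(1)] gcd_eq[of y b x a] that assms(1)
    by (simp_all add: mult.commute coprime_commute)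
  have "(\<Sum>d | d dvd a. f d) * (\<Sum>d | d dvd b. f d)
      = (\<Sum>(x, y)\<in>{d. d dvd a} \<times> {d. d dvd b}. f x * f y)"
    by (simp add: sum_product sum.cartesian_product)
  also have "\<dots> = (\<Sum>d | d dvd a * b. f d)"
  proof (rule sum.reindex_bij_witness[of _ "\<lambda>d. (gcd d a, gcd d b)" "\<lambda>(x, y). x * y"])
    fix d assume "d \<in> {d. d dvd a * b}"
    then obtain x y where "d = x * y" "x dvd a" "y dvd b" using division_decomp[of d a b] by auto
    then show "(case (gcd d a, gcd d b) of (x, y) \<Rightarrow> x * y) = d" by (simp add: 1)
  qed (auto simp: 1 mult intro: mult_dvd_mono)
  finally show ?thesis ..
qed

text \<open>Multiplicativity reduces both claims to prime powers. There the sum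
  \<open>1 + x + ... + x ^ k\<close> with \<open>x\<close> in \<open>{-1, 0, 1}\<close> is never
  negative, and it is at least 1 when \<open>k\<close> is even.\<close>

lemma
  fixes \<psi> :: "nat \<Rightarrow> real"
  assumes mult: "\<And>a b. \<psi> (a * b) = \<psi> a * \<psi> b" and val: "\<And>a. \<psi> a \<in> {-1, 0, 1}" and one: "\<psi> 1 = 1"
    and n: "n > 0"
  shows sum_divisors_character_nonneg: "(\<Sum>d | d dvd n. \<psi> d) \<ge> 0"
    and sum_divisors_character_square: "(\<Sum>d | d dvd n\<^sup>2. \<psi> d) \<ge> 1"
proof -
  have pow: "\<psi> (p ^ k) = \<psi> p ^ k" for p k
    by (induction k) (use one mult in simp_all)
  have pp: "(\<Sum>d | d dvd p ^ k * m. \<psi> d) = (\<Sum>i\<le>k. \<psi> p ^ i) * (\<Sum>d | d dvd m. \<psi> d)"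
    if "prime p" "\<not> p dvd m" "m > 0" for p k m
  proof -
    have "coprime (p ^ k) m" using that prime_imp_coprime by auto
    then have "(\<Sum>d | d dvd p ^ k * m. \<psi> d) = (\<Sum>d | d dvd p ^ k. \<psi> d) * (\<Sum>d | d dvd m. \<psi> d)"
      using that prime_gt_0_nat by (intro sum_divisors_coprime_mult mult) auto
    also have "{d. d dvd p ^ k} = (\<lambda>i. p ^ i) ` {..k}"
      using that by (auto simp: divides_primepow_nat le_imp_power_dvd)
    also have "(\<Sum>d\<in>\<dots>. \<psi> d) = (\<Sum>i\<le>k. \<psi> p ^ i)"
      using prime_gt_1_nat[OF that(1)] by (subst sum.reindex) (auto simp: inj_on_def pow)
    finally show ?thesis .
  qed
  have geo: "(\<Sum>i\<le>k. x ^ i) = (if x = 0 then 1 else if x = 1 then real k + 1 else if even k then 1 else 0)"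
    if "x \<in> {-1, 0, 1}" for x :: real and k
    using that by (induction k) (auto simp: power_0_left)
  show "(\<Sum>d | d dvd n. \<psi> d) \<ge> 0"
    using n
  proof (induction n rule: prime_power_mult_induct)
    case (step p k m)
    then show ?case using geo[OF val, of p k] by (simp add: pp)
  qed (simp add: one[simplified])
  show "(\<Sum>d | d dvd n\<^sup>2. \<psi> d) \<ge> 1"
    using n
  proof (induction n rule: prime_power_mult_induct)
    case (step p k m)
    have "(p ^ k * m)\<^sup>2 = p ^ (2 * k) * m\<^sup>2" by (simp add: power_mult_distrib power_mult[symmetric] mult.commute)
    moreover have "\<not> p dvd m\<^sup>2" using step by (simp add: prime_dvd_power_iff)
    moreover have "(\<Sum>i\<le>2 * k. \<psi> p ^ i) \<ge> 1" using geo[OF val, of p "2 * k"] by simp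
    ultimately show ?case using step pp[of p "m\<^sup>2" "2 * k"]
      by (simp add: mult_ge1_I)
  qed (simp add: one[simplified])
qed

text \<open>The terms with indices \<open>i\<close> and \<open>n - 1 - i\<close> have geometric mean
  \<open>s ^ (n - 1)\<close>, hence an arithmetic mean at least as large. Writing the ratio as a
  square keeps this exponent integral.\<close>

lemma geometric_sum_lower:
  assumes "0 \<le> (s::real)"
  shows "real n * s ^ (n - 1) \<le> (\<Sum>i<n. (s\<^sup>2) ^ i)"
proof -
  have "2 * (real n * s ^ (n - 1)) = (\<Sum>i<n. 2 * s ^ (n - 1))" by simp
  also have "\<dots> \<le> (\<Sum>i<n. (s\<^sup>2) ^ i + (s\<^sup>2) ^ (n - Suc i))"
  proof (rule sum_mono)
    fix i assume "i \<in> {..<n}"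
    then have "s ^ (n - 1) = s ^ i * s ^ (n - Suc i)" by (simp flip: power_add)
    moreover have "2 * (s ^ i * s ^ (n - Suc i)) \<le> (s ^ i)\<^sup>2 + (s ^ (n - Suc i))\<^sup>2"
      using sum_squares_bound[of "s ^ i" "s ^ (n - Suc i)"] by (simp add: mult.assoc)
    ultimately show "2 * s ^ (n - 1) \<le> (s\<^sup>2) ^ i + (s\<^sup>2) ^ (n - Suc i)"
      by (simp add: power_mult[symmetric] mult.commute)
  qed
  also have "\<dots> = 2 * (\<Sum>i<n. (s\<^sup>2) ^ i)"
    using sum.nat_diff_reindex[of "\<lambda>i. (s\<^sup>2) ^ i" n] by (simp add: sum.distrib)
  finally show ?thesis by simp
qed

text \<open>With \<open>L(1, \<psi>) = 0\<close> the Lambert series equals \<open>- \<Sum> \<psi>(n) * lambert_gap t n\<close>, and the gap is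
  decreasing in \<open>n\<close> with first term 1 (Monsky).\<close>

definition lambert_gap :: "real \<Rightarrow> nat \<Rightarrow> real" where
  "lambert_gap t n = 1 / (real n * (1 - t)) - t ^ n / (1 - t ^ n)"

text \<open>Let \<open>g n = (\<Sum>i<n. t ^ i)\<close>, so that
  \<open>1 - t ^ n = (1 - t) * g n\<close>. Nonnegativity means \<open>n * t ^ n \<le> g n\<close>;
  monotonicity reduces, by \<open>g (Suc n) - t * g n = 1\<close>, to
  \<open>n * Suc n * t ^ n \<le> g n * g (Suc n)\<close>. Both follow from
  \<open>geometric_sum_lower\<close>.\<close>

lemma
  assumes s: "0 < s" "s < 1" and n: "n > 0"
  shows lambert_gap_nonneg: "0 \<le> lambert_gap (s\<^sup>2) n"
    and lambert_gap_decreasing: "lambert_gap (s\<^sup>2) (Suc n) \<le> lambert_gap (s\<^sup>2) n"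
proof -
  define t where "t = s\<^sup>2"
  have t: "0 < t" "t < 1" using s by (auto simp: t_def power_less_one_iff)
  define g where "g n = (\<Sum>i<n. t ^ i)" for n
  have geo: "1 - t ^ n = (1 - t) * g n" for n
    using one_diff_power_eq[of t n] by (simp add: g_def)
  have lower: "real n * s ^ (n - 1) \<le> g n" for n
    using geometric_sum_lower[of s n] s by (simp add: g_def t_def)
  have gpos: "g n > 0" if "n > 0" for n
    using that s by (intro less_le_trans[OF _ lower]) simp
  have gap: "lambert_gap t n = (1 / n - t ^ n / g n) / (1 - t)" if "n > 0" for n
    using t gpos[OF that] that by (simp add: lambert_gap_def geo diff_divide_distrib mult.commute)
  have tn: "t ^ n = s ^ n * s ^ n" for n by (simp add: t_def power2_eq_square power_mult_distrib)
  have sle: "s ^ n \<le> 1" for n using s by (simp add: power_le_one)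
  have "real n * t ^ n \<le> real n * s ^ (n - 1)"
  proof (intro mult_left_mono)
    have "t ^ n \<le> s ^ n" using sle[of n] s unfolding tn by (simp add: mult_left_le)
    also have "\<dots> \<le> s ^ (n - 1)" using s by (intro power_decreasing) auto
    finally show "t ^ n \<le> s ^ (n - 1)" .
  qed simp
  also have "\<dots> \<le> g n" by (rule lower)
  finally have "t ^ n / g n \<le> 1 / n" using gpos[OF n] n by (simp add: field_simps)
  then show "0 \<le> lambert_gap (s\<^sup>2) n" using gap[OF n] t by (simp add: t_def)
  have "(real n * s ^ (n - 1)) * (real (Suc n) * s ^ n) \<le> g n * g (Suc n)"
    using lower[of n] lower[of "Suc n"] s gpos[OF n] by (intro mult_mono) auto
  moreover have "real n * real (Suc n) * t ^ n \<le> real n * real (Suc n) * (s ^ (n - 1) * s ^ n)"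
  proof (intro mult_left_mono)
    show "t ^ n \<le> s ^ (n - 1) * s ^ n"
      unfolding tn using s by (intro mult_right_mono power_decreasing) auto
  qed simp
  ultimately have key: "real n * real (Suc n) * t ^ n \<le> g n * g (Suc n)" by (simp add: mult_ac)
  have "t ^ n / g n - t ^ Suc n / g (Suc n) = t ^ n * (g (Suc n) - t * g n) / (g n * g (Suc n))"
    using gpos[OF n] gpos[of "Suc n"] by (simp add: field_simps)
  also have "g (Suc n) - t * g n = 1"
    unfolding g_def sum.lessThan_Suc_shift by (simp add: sum_distrib_left)
  also have "t ^ n * 1 / (g n * g (Suc n)) \<le> 1 / (real n * real (Suc n))"
  proof -
    have "x / G \<le> 1 / A" if "A * x \<le> G" "0 < A" "0 < G" for x A G :: real
      using that by (simp add: field_simps)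
    from this[OF key] show ?thesis using gpos[OF n] gpos[of "Suc n"] n by simp
  qed
  also have "\<dots> = 1 / n - 1 / Suc n" using n by (simp add: field_simps)
  finally have "1 / Suc n - t ^ Suc n / g (Suc n) \<le> 1 / n - t ^ n / g n" by simp
  then show "lambert_gap (s\<^sup>2) (Suc n) \<le> lambert_gap (s\<^sup>2) n"
    using gap[OF n] gap[of "Suc n"] t by (simp add: t_def divide_right_mono)
qed

text \<open>If the value were 0, every finite section of \<open>\<Sum> r n * t ^ n\<close> would be
  at most \<open>C\<close> uniformly for \<open>0 < t < 1\<close>, and \<open>t\<close> tending to 1
  would bound the sums of \<open>r\<close>. But \<open>r\<close> is nonnegative and at least 1 at
  each square.\<close>

lemma L_one_real_character_nonzero:
  fixes \<psi> :: "nat \<Rightarrow> real"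
  assumes mult: "\<And>a b. \<psi> (a * b) = \<psi> a * \<psi> b" and val: "\<And>a. \<psi> a \<in> {-1, 0, 1}" and one: "\<psi> 1 = 1"
    and bs: "bounded_sums \<psi> C"
  shows "L_one \<psi> \<noteq> 0"
proof
  assume zero: "L_one \<psi> = 0"
  define r where "r n = (\<Sum>d | d dvd n. \<psi> d)" for n
  have r_nonneg: "r n \<ge> 0" if "n > 0" for n
    unfolding r_def by (rule sum_divisors_character_nonneg[OF mult val one that])
  have r_square: "r (n\<^sup>2) \<ge> 1" if "n > 0" for n
    unfolding r_def by (rule sum_divisors_character_square[OF mult val one that])
  have C: "0 \<le> C" by (rule bounded_sums_nonneg[OF bs])
  have bound: "(\<Sum>n=1..N. r n * t ^ n) \<le> C" if s: "0 < s" "s < 1" "t = s\<^sup>2" for N s t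
  proof -
    have t: "0 < t" "t < 1" using s by (auto simp: power_less_one_iff)
    \<comment> \<open>\<open>N'\<close> is a second cutoff, sent to infinity while \<open>t\<close>
      is fixed. The three terms account for the partial sum of the vanishing series, the
      \<open>lambert_gap\<close> part, and the truncation of the inner geometric series.\<close>
    have part: "(\<Sum>n=1..N. r n * t ^ n) \<le> C / real (Suc N') / (1 - t) + C + (real N' * t ^ N') * (t / (1 - t))"
      if "N \<le> N'" for N'
    proof -
      have "(\<Sum>n=1..N. r n * t ^ n) \<le> (\<Sum>n=1..N'. r n * t ^ n)"
        using that t r_nonneg by (intro sum_mono2) auto
      also have "\<dots> = (\<Sum>n=1..N'. \<Sum>d | d dvd n. \<psi> d * t ^ (d * (n div d)))"
        by (intro sum.cong refl) (auto simp: r_def sum_distrib_right intro!: sum.cong)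
      also have "\<dots> = (\<Sum>d=1..N'. \<Sum>j=1..N' div d. \<psi> d * t ^ (d * j))"
        by (rule sum_divisors_swap)
      also have "\<dots> = (\<Sum>d=1..N'. \<psi> d / d * (1 / (1 - t)) - \<psi> d * lambert_gap t d
            - \<psi> d * (t ^ (d * (N' div d + 1)) / (1 - t ^ d)))"
      proof (intro sum.cong refl)
        fix d assume d: "d \<in> {1..N'}"
        define q where "q = N' div d"
        have td: "t ^ d < 1" using t d by (simp add: power_less_one_iff)
        have "(\<Sum>j=1..q. t ^ (d * j)) = (t ^ d - t ^ (d * (q + 1))) / (1 - t ^ d)"
        proof -
          have "(1 - t ^ d) * (\<Sum>j=1..q. t ^ (d * j)) = t ^ d - t ^ (d * (q + 1))"
          proof (induction q)
            case (Suc q)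
            have "(1 - t ^ d) * (\<Sum>j=1..Suc q. t ^ (d * j))
                = (1 - t ^ d) * (\<Sum>j=1..q. t ^ (d * j)) + (1 - t ^ d) * t ^ (d * Suc q)"
              by (simp add: distrib_left)
            also have "\<dots> = t ^ d - t ^ (d * (Suc q + 1))"
              unfolding Suc.IH by (simp add: algebra_simps power_add)
            finally show ?case .
          qed simp
          then show ?thesis using td by (simp add: field_simps)
        qed
        then show "(\<Sum>j=1..N' div d. \<psi> d * t ^ (d * j)) = \<psi> d / d * (1 / (1 - t)) - \<psi> d * lambert_gap t d
            - \<psi> d * (t ^ (d * (N' div d + 1)) / (1 - t ^ d))"
          unfolding sum_distrib_left[symmetric] q_def[symmetric]
          by (simp add: lambert_gap_def diff_divide_distrib right_diff_distrib)
      qed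
      also have "\<dots> = (\<Sum>d=1..N'. \<psi> d / d) / (1 - t) - (\<Sum>d=1..N'. \<psi> d * lambert_gap t d)
            - (\<Sum>d=1..N'. \<psi> d * (t ^ (d * (N' div d + 1)) / (1 - t ^ d)))"
        by (simp add: sum_subtractf sum_divide_distrib)
      also have "\<dots> \<le> C / real (Suc N') / (1 - t) + C + (real N' * t ^ N') * (t / (1 - t))"
      proof -
        have 1: "(\<Sum>d=1..N'. \<psi> d / d) / (1 - t) \<le> C / real (Suc N') / (1 - t)"
          using L_one_approx[OF bs, of N'] zero t by (intro divide_right_mono) auto
        have "\<bar>\<Sum>k<n. \<psi> (1 + k)\<bar> \<le> C" for n
          using bs unfolding bounded_sums_def by blast
        then have "\<bar>\<Sum>k<N'. \<psi> (1 + k) * lambert_gap t (Suc k)\<bar> \<le> C * lambert_gap t (Suc 0)"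
          using lambert_gap_nonneg lambert_gap_decreasing s by (intro summation_by_parts_bound) auto
        moreover have "lambert_gap t (Suc 0) = 1"
          using t by (simp add: lambert_gap_def field_simps)
        ultimately have 2: "\<bar>\<Sum>d=1..N'. \<psi> d * lambert_gap t d\<bar> \<le> C"
          unfolding sum_atLeast1_lessThan by simp
        have "\<bar>\<Sum>d=1..N'. \<psi> d * (t ^ (d * (N' div d + 1)) / (1 - t ^ d))\<bar>
            \<le> (\<Sum>d=1..N'. t ^ (N' + 1) / (1 - t))"
        proof (intro order_trans[OF sum_abs] sum_mono)
          fix d assume d: "d \<in> {1..N'}"
          have td: "t ^ d \<le> t" using t d power_decreasing[of 1 d t] by simp
          \<comment> \<open>The first omitted exponent is the first multiple of \<open>d\<close>
            beyond \<open>N'\<close>.\<close>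
          have "N' + 1 \<le> d * (N' div d + 1)"
            using d dividend_less_div_times[of d N'] by (simp add: algebra_simps Suc_le_eq)
          then have "t ^ (d * (N' div d + 1)) \<le> t ^ (N' + 1)"
            using t by (intro power_decreasing) auto
          then have "t ^ (d * (N' div d + 1)) / (1 - t ^ d) \<le> t ^ (N' + 1) / (1 - t)"
            using t td by (intro frac_le) auto
          moreover have "\<bar>\<psi> d\<bar> \<le> 1" using val[of d] by auto
          moreover have "0 \<le> t ^ (d * (N' div d + 1)) / (1 - t ^ d)" using t td by simp
          ultimately have "\<bar>\<psi> d\<bar> * (t ^ (d * (N' div d + 1)) / (1 - t ^ d)) \<le> 1 * (t ^ (N' + 1) / (1 - t))"
            by (intro mult_mono) auto
          then show "\<bar>\<psi> d * (t ^ (d * (N' div d + 1)) / (1 - t ^ d))\<bar> \<le> t ^ (N' + 1) / (1 - t)"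
            using \<open>0 \<le> t ^ (d * (N' div d + 1)) / (1 - t ^ d)\<close> by (simp only: abs_mult abs_of_nonneg mult_1)
        qed
        then have 3: "\<bar>\<Sum>d=1..N'. \<psi> d * (t ^ (d * (N' div d + 1)) / (1 - t ^ d))\<bar>
            \<le> (real N' * t ^ N') * (t / (1 - t))" by (simp add: mult_ac)
        show ?thesis using 1 2 3 by linarith
      qed
      finally show ?thesis .
    qed
    have "(\<lambda>N'. C / real (Suc N') / (1 - t) + C + (real N' * t ^ N') * (t / (1 - t)))
        \<longlonglongrightarrow> 0 / (1 - t) + C + 0 * (t / (1 - t))"
      using t by (intro tendsto_intros powser_times_n_limit_0 LIMSEQ_Suc[OF lim_const_over_n]) auto
    then have "(\<lambda>N'. C / real (Suc N') / (1 - t) + C + (real N' * t ^ N') * (t / (1 - t))) \<longlonglongrightarrow> C"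
      by simp
    then show ?thesis using part by (intro LIMSEQ_le_const) auto
  qed
  have "(\<Sum>n=1..N. r n) \<le> C" for N
  proof -
    have "((\<lambda>s::real. \<Sum>n=1..N. r n * (s\<^sup>2) ^ n) \<longlongrightarrow> (\<Sum>n=1..N. r n * (1\<^sup>2) ^ n)) (at_left 1)"
      by (intro tendsto_intros)
    moreover have "\<forall>\<^sub>F s in at_left (1::real). (\<Sum>n=1..N. r n * (s\<^sup>2) ^ n) \<le> C"
      using eventually_at_left_real[of 0 "1::real"]
    proof (rule eventually_mono)
      show "(\<Sum>n=1..N. r n * (s\<^sup>2) ^ n) \<le> C" if "s \<in> {0<..<1}" for s
        using that bound[of s "s\<^sup>2" N] by simp
    qed simp
    ultimately have "(\<Sum>n=1..N. r n * (1\<^sup>2) ^ n) \<le> C"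
      by (intro tendsto_upperbound) (auto simp: trivial_limit_at_left_real)
    then show ?thesis by simp
  qed
  moreover obtain m :: nat where m: "C < real m" using reals_Archimedean2 by blast
  moreover have "real m \<le> (\<Sum>n=1..m\<^sup>2. r n)"
  proof -
    have "real m = (\<Sum>k=1..m. 1)" by simp
    also have "\<dots> \<le> (\<Sum>k=1..m. r (k\<^sup>2))" using r_square by (intro sum_mono) auto
    also have "\<dots> = (\<Sum>n\<in>(\<lambda>k. k\<^sup>2) ` {1..m}. r n)"
      by (subst sum.reindex) (auto simp: inj_on_def)
    also have "\<dots> \<le> (\<Sum>n=1..m\<^sup>2. r n)"
      by (intro sum_mono2) (auto intro!: r_nonneg simp: power_mono)
    finally show ?thesis .
  qed
  ultimately show False by (meson not_less order_trans)
qed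

section \<open>Nonvanishing at one\<close>

lemma sum_periodic_mult:
  fixes f :: "nat \<Rightarrow> real"
  assumes per: "\<And>k. f (k + M) = f k" and "coprime d M" "M > 0"
  shows "(\<Sum>k<M. f (d * k)) = (\<Sum>k<M. f k)"
proof -
  have inj: "inj_on (\<lambda>k. d * k mod M) {..<M}"
  proof (rule inj_onI)
    fix x y assume xy: "x \<in> {..<M}" "y \<in> {..<M}" "d * x mod M = d * y mod M"
    then have "[x = y] (mod M)" using assms by (simp add: cong_mult_lcancel_nat flip: cong_def)
    then show "x = y" using xy by (simp add: cong_def)
  qed
  have "(\<lambda>k. d * k mod M) ` {..<M} = {..<M}"
    using assms inj by (intro endo_inj_surj) auto
  then have "(\<Sum>k<M. f k) = (\<Sum>k<M. f (d * k mod M))"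
    using sum.reindex[OF inj, of f] by simp
  also have "\<dots> = (\<Sum>k<M. f (d * k))"
    by (intro sum.cong refl periodic_mod per)
  finally show ?thesis ..
qed

text \<open>The last clause is orthogonality to the principal character modulo \<open>M\<close>,
  which makes the series at 1 converge.\<close>

definition unit_periodic :: "nat \<Rightarrow> (nat \<Rightarrow> real) \<Rightarrow> bool" where
  "unit_periodic M F \<longleftrightarrow> (\<forall>k. F (k + M) = F k) \<and> (\<forall>k. \<not> coprime k M \<longrightarrow> F k = 0) \<and> (\<Sum>k<M. F k) = 0"

text \<open>By Mertens the weights of all residues add up to \<open>ln N + O(1)\<close>, so they act
  as unnormalised logarithmic densities.\<close>

definition prime_weight :: "nat \<Rightarrow> nat \<Rightarrow> nat \<Rightarrow> real" where
  "prime_weight M a N = (\<Sum>d | d \<in> {1..N} \<and> d mod M = a. mangoldt d / d)"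

lemma prime_weight_nonneg: "0 \<le> prime_weight M a N"
  unfolding prime_weight_def by (intro sum_nonneg divide_nonneg_nonneg mangoldt_nonneg) auto

context
  fixes M :: nat
  assumes M: "M > 0"
begin

lemma unit_periodic_mult:
  assumes "unit_periodic M F"
  shows "unit_periodic M (\<lambda>k. F (c * k))"
proof (cases "coprime c M")
  case True
  have per: "F (k + M) = F k" for k using assms by (simp add: unit_periodic_def)
  have "F (c * (k + M)) = F (c * k)" for k
    by (rule periodic_cong[of F M, OF per]) (simp add: cong_def distrib_left)
  then show ?thesis
    using assms sum_periodic_mult[of F M c, OF per True M] by (simp add: unit_periodic_def)
next
  case False
  then have "F (c * k) = 0" for k using assms by (simp add: unit_periodic_def)
  then show ?thesis by (simp add: unit_periodic_def)
qed

text \<open>Units permute the residues and other multipliers annihilate \<open>F\<close>, so one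
  constant serves all dilations, as the mean value estimates require.\<close>

lemma unit_periodic_bounded_sums:
  assumes "unit_periodic M F"
  shows "bounded_sums (\<lambda>k. F (d * k)) (\<Sum>k<M. \<bar>F k\<bar>)"
proof (cases "coprime d M")
  case True
  have "bounded_sums (\<lambda>k. F (d * k)) (\<Sum>k<M. \<bar>F (d * k)\<bar>)"
    using unit_periodic_mult[OF assms, of d] M
    by (intro bounded_sums_periodic) (auto simp: unit_periodic_def)
  then show ?thesis
    using sum_periodic_mult[of "\<lambda>k. \<bar>F k\<bar>" M d] True M assms by (simp add: unit_periodic_def)
next
  case False
  then have "F (d * k) = 0" for k using assms by (simp add: unit_periodic_def)
  then show ?thesis by (simp add: bounded_sums_def sum_nonneg)
qed

lemma sum_mangoldt_by_residue:
  assumes "\<And>d. H (d mod M) = H d"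
  shows "(\<Sum>d=1..N. mangoldt d / d * H d) = (\<Sum>a<M. H a * prime_weight M a N)"
proof -
  have "(\<Sum>d=1..N. mangoldt d / d * H d)
      = (\<Sum>a<M. \<Sum>d | d \<in> {1..N} \<and> d mod M = a. mangoldt d / d * H d)"
    using M by (intro sum.group[symmetric]) auto
  also have "\<dots> = (\<Sum>a<M. H a * prime_weight M a N)"
    unfolding prime_weight_def sum_distrib_left
    by (intro sum.cong refl) (use assms in \<open>auto simp: mult.commute\<close>)
  finally show ?thesis .
qed

lemma sum_prime_weight_bigo_1:
  "(\<lambda>N. (\<Sum>a<M. prime_weight M a N) - ln N) \<in> O(\<lambda>_. 1)"
proof (rule bounded_imp_bigo_1)
  fix N :: nat assume N: "N > 0"
  have "(\<Sum>a<M. prime_weight M a N) = (\<Sum>d=1..N. mangoldt d / d)"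
    using sum_mangoldt_by_residue[of "\<lambda>_. 1" N] by simp
  then show "\<bar>(\<Sum>a<M. prime_weight M a N) - ln N\<bar> \<le> 4"
    using mertens_lower[OF N] mertens_upper[OF N] by simp
qed

lemma sum_L_one_prime_weight_bigo_1:
  assumes F: "unit_periodic M F"
  shows "(\<lambda>N. \<Sum>a<M. L_one (\<lambda>k. F (a * k)) * prime_weight M a N) \<in> O(\<lambda>_. 1)"
proof -
  have per: "F (k + M) = F k" for k using F by (simp add: unit_periodic_def)
  have "F (d mod M * k) = F (d * k)" for d k
    by (rule periodic_cong[of F M, OF per]) (simp add: cong_def mod_simps)
  then have "(\<Sum>a<M. L_one (\<lambda>k. F (a * k)) * prime_weight M a N)
      = (\<Sum>d=1..N. mangoldt d / d * L_one (\<lambda>k. F (d * k)))" for N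
    by (intro sum_mangoldt_by_residue[symmetric]) simp
  then show ?thesis
    using sum_mangoldt_L_one_bigo_1[OF unit_periodic_bounded_sums[OF F]] by simp
qed

lemma sum_prime_weight_of_L_one_zero:
  assumes F: "unit_periodic M F" and zero: "\<And>d. d > 0 \<Longrightarrow> L_one (\<lambda>k. F (d * k)) = 0"
  shows "(\<lambda>N. (\<Sum>a<M. F a * prime_weight M a N) + F 1 * ln N) \<in> O(\<lambda>_. 1)"
proof -
  have "F (d mod M) = F d" for d
    using F by (intro periodic_mod) (simp add: unit_periodic_def)
  then have "(\<Sum>a<M. F a * prime_weight M a N) = (\<Sum>d=1..N. mangoldt d / d * F d)" for N
    by (intro sum_mangoldt_by_residue[symmetric])
  then show ?thesis
    using sum_mangoldt_of_L_one_zero[OF unit_periodic_bounded_sums[OF F] zero] by simp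
qed

text \<open>The multiplier \<open>c = 0\<close> has to be covered because later sums run over all
  \<open>c < M\<close>. In that case \<open>F 0 = 0\<close>, by the zero sum if \<open>M = 1\<close>
  and because 0 is not a unit otherwise.\<close>

lemma unit_periodic_L_one_mult_zero:
  assumes F: "unit_periodic M F" and zero: "\<And>d. d > 0 \<Longrightarrow> L_one (\<lambda>k. F (d * k)) = 0"
    and d: "d > 0"
  shows "L_one (\<lambda>k. F (c * (d * k))) = 0"
proof (cases "c = 0")
  case True
  have "F 0 = 0"
  proof (cases "M = 1")
    case True
    then show ?thesis using F by (simp add: unit_periodic_def)
  qed (use F in \<open>auto simp: unit_periodic_def\<close>)
  then show ?thesis using True by (simp add: L_one_def)
next
  case False
  then show ?thesis using zero[of "c * d"] d by (simp add: mult.assoc)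
qed

text \<open>If \<open>S a = \<Sum> \<Lambda>(d) / d\<close> over \<open>d \<equiv> a\<close> is unbounded, then multiplication by \<open>a\<close> negates \<open>F\<close>: the
  \<open>S\<close>-weighted mean of the translates of \<open>F\<close> is \<open>- F\<close>, and this is an extreme case of the
  triangle inequality in \<open>\<ell>\<^sup>2\<close>.\<close>

lemma negated_of_prime_weight_unbounded:
  assumes F: "unit_periodic M F" and zero: "\<And>d. d > 0 \<Longrightarrow> L_one (\<lambda>k. F (d * k)) = 0"
    and a: "a < M" "prime_weight M a \<notin> O(\<lambda>_. 1)"
  shows "F (a * c) = - F c"
proof -
  have per: "F (k + M) = F k" for k using F by (simp add: unit_periodic_def)
  define E where "E = (\<Sum>c<M. (F c)\<^sup>2)"
  define X where "X b = (\<Sum>c<M. F c * F (c * b))" for b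
  define Q where "Q b = (\<Sum>c<M. (F (b * c) + F c)\<^sup>2)" for b
  \<comment> \<open>Multiplication by \<open>b\<close> permutes the residues or kills
    \<open>F\<close>, so it does not increase the square norm \<open>E\<close>; \<open>X b\<close>
    is the correlation of \<open>F\<close> with its translate.\<close>
  have Q: "Q b \<le> 2 * E + 2 * X b" for b
  proof -
    have "(\<Sum>c<M. (F (b * c))\<^sup>2) \<le> E"
    proof (cases "coprime b M")
      case True
      then show ?thesis
        using sum_periodic_mult[of "\<lambda>k. (F k)\<^sup>2" M b] per M by (simp add: E_def)
    next
      case False
      then have "F (b * k) = 0" for k using F by (simp add: unit_periodic_def)
      then show ?thesis by (simp add: E_def sum_nonneg)
    qed
    moreover have "Q b = (\<Sum>c<M. (F (b * c))\<^sup>2) + E + 2 * X b"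
      by (simp add: X_def Q_def E_def power2_sum sum.distrib sum_distrib_left mult_ac)
    ultimately show ?thesis by simp
  qed
  \<comment> \<open>The estimate for vanishing L-values, applied to each translate of
    \<open>F\<close>, gives \<open>- E * ln N + O(1)\<close> for the weighted sum of
    \<open>X\<close>. This cancels the logarithm in the total weight, so \<open>G\<close> is
    bounded.\<close>
  define G where "G N = 2 * E * ((\<Sum>b<M. prime_weight M b N) - ln N)
      + 2 * (\<Sum>c<M. F c * ((\<Sum>b<M. F (c * b) * prime_weight M b N) + F (c * 1) * ln N))" for N :: nat
  have "(\<lambda>N. (\<Sum>b<M. F (c * b) * prime_weight M b N) + F (c * 1) * ln N) \<in> O(\<lambda>_. 1)" for c
    using unit_periodic_L_one_mult_zero[OF F zero]
    by (intro sum_prime_weight_of_L_one_zero unit_periodic_mult F)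
  then have "(\<lambda>N. \<Sum>c<M. F c * ((\<Sum>b<M. F (c * b) * prime_weight M b N) + F (c * 1) * ln N)) \<in> O(\<lambda>_. 1)"
    by (intro big_sum_in_bigo) (simp only: cmult_in_bigo_iff simp_thms)
  then have G: "G \<in> O(\<lambda>_. 1)"
    unfolding G_def using sum_prime_weight_bigo_1
    by (intro sum_in_bigo) (simp_all only: cmult_in_bigo_iff simp_thms mult.assoc)
  have Q_nonneg: "0 \<le> Q b" for b by (simp add: Q_def sum_nonneg)
  have le_G: "Q a * prime_weight M a N \<le> G N" for N
  proof -
    have "Q a * prime_weight M a N \<le> (\<Sum>b<M. Q b * prime_weight M b N)"
      using a by (intro member_le_sum) (auto intro!: mult_nonneg_nonneg Q_nonneg prime_weight_nonneg)
    also have "\<dots> \<le> (\<Sum>b<M. (2 * E + 2 * X b) * prime_weight M b N)"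
      by (intro sum_mono mult_right_mono Q prime_weight_nonneg)
    also have "\<dots> = 2 * E * (\<Sum>b<M. prime_weight M b N)
        + 2 * (\<Sum>b<M. X b * prime_weight M b N)"
      by (simp add: distrib_right sum.distrib sum_distrib_left mult.assoc)
    also have "(\<Sum>b<M. X b * prime_weight M b N) = (\<Sum>b<M. \<Sum>c<M. F c * F (c * b) * prime_weight M b N)"
      by (simp add: X_def sum_distrib_right)
    also have "\<dots> = (\<Sum>c<M. F c * (\<Sum>b<M. F (c * b) * prime_weight M b N))"
      by (subst sum.swap) (simp add: sum_distrib_left mult_ac)
    also have "2 * E * (\<Sum>b<M. prime_weight M b N) + 2 * \<dots> = G N"
    proof -
      have "(\<Sum>c<M. F c * ((\<Sum>b<M. F (c * b) * prime_weight M b N) + F (c * 1) * ln N))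
          = (\<Sum>c<M. F c * (\<Sum>b<M. F (c * b) * prime_weight M b N)) + E * ln N"
        by (simp add: E_def distrib_left sum.distrib sum_distrib_right power2_eq_square mult.assoc)
      then show ?thesis unfolding G_def by (simp add: algebra_simps)
    qed
    finally show ?thesis .
  qed
  have "(\<lambda>N. Q a * prime_weight M a N) \<in> O(\<lambda>_. 1)"
    by (rule bigo_1_mono[OF G _ le_G]) (intro mult_nonneg_nonneg Q_nonneg prime_weight_nonneg)
  \<comment> \<open>A nonzero constant \<open>Q a\<close> would make \<open>prime_weight M a\<close>
    itself bounded.\<close>
  then have "Q a = 0" using a(2) by auto
  then have "F (a * (c mod M)) + F (c mod M) = 0"
    using M by (auto simp: Q_def sum_nonneg_eq_0_iff)
  moreover have "F (c mod M) = F c" by (rule periodic_mod[of F M, OF per])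
  moreover have "F (a * (c mod M)) = F (a * c)"
    by (rule periodic_cong[of F M, OF per]) (simp add: cong_def mod_simps)
  ultimately show ?thesis by simp
qed

text \<open>\<open>K\<close> consists of the multipliers that act on \<open>F\<close> by a sign.
  Residues outside \<open>K\<close> carry only bounded prime weight, and this forces
  \<open>K\<close> to contain every unit. Then \<open>F / F 1\<close> is a real character with
  vanishing value at 1, which is impossible.\<close>

lemma unit_periodic_L_one_zero_imp_zero:
  assumes F: "unit_periodic M F" and zero: "\<And>d. d > 0 \<Longrightarrow> L_one (\<lambda>k. F (d * k)) = 0"
  shows "F k = 0"
proof (rule ccontr)
  assume Fk: "F k \<noteq> 0"
  have per: "F (k + M) = F k" and nc: "\<not> coprime k M \<Longrightarrow> F k = 0" for k
    using F by (auto simp: unit_periodic_def)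
  define K where "K = {a. (\<forall>c. F (a * c) = F c) \<or> (\<forall>c. F (a * c) = - F c)}"
  have K_coprime: "coprime a M" if "a \<in> K" for a
  proof (rule ccontr)
    assume "\<not> coprime a M"
    then have "F (a * k) = 0" by (intro nc) simp
    then show False using that Fk by (auto simp: K_def)
  qed
  have K_mult: "a * c \<in> K \<longleftrightarrow> c \<in> K" if aK: "a \<in> K" for a c
  proof -
    consider "\<And>x. F (a * x) = F x" | "\<And>x. F (a * x) = - F x" using aK unfolding K_def by blast
    then show ?thesis
    proof cases
      case 2
      then have "F (a * c * x) = F x \<longleftrightarrow> F (c * x) = - F x" "F (a * c * x) = - F x \<longleftrightarrow> F (c * x) = F x" for x
        by (auto simp: mult.assoc)
      then show ?thesis unfolding K_def by auto
    qed (simp add: K_def mult.assoc)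
  qed
  have K_per: "a + M \<in> K \<longleftrightarrow> a \<in> K" for a
  proof -
    have "F ((a + M) * c) = F (a * c)" for c
      by (rule periodic_cong[of F M, OF per]) (simp add: cong_def distrib_right)
    then show ?thesis by (simp add: K_def)
  qed
  have K_weight: "prime_weight M a \<in> O(\<lambda>_. 1)" if "a < M" "a \<notin> K" for a
    using negated_of_prime_weight_unbounded[OF F zero \<open>a < M\<close>] that by (auto simp: K_def)
  \<comment> \<open>Up to O(1) the prime weight is concentrated on \<open>K\<close>, so a function
    constant on \<open>K\<close> has weighted sum equal to its value at 1 times the total
    weight.\<close>
  have K_weight_sum: "(\<lambda>N. h 1 * (\<Sum>a<M. prime_weight M a N) - (\<Sum>a<M. h a * prime_weight M a N)) \<in> O(\<lambda>_. 1)"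
    if "\<And>a. a \<in> K \<Longrightarrow> h a = h 1" for h :: "nat \<Rightarrow> real"
  proof -
    have "(\<lambda>N. \<Sum>a<M. (h 1 - h a) * prime_weight M a N) \<in> O(\<lambda>_. 1)"
    proof (intro big_sum_in_bigo)
      fix a assume "a \<in> {..<M}"
      then show "(\<lambda>N. (h 1 - h a) * prime_weight M a N) \<in> O(\<lambda>_. 1)"
        using that[of a] K_weight[of a] by (cases "a \<in> K") auto
    qed
    then show ?thesis by (simp add: left_diff_distrib sum_subtractf sum_distrib_left)
  qed
  have coprime_K: "b \<in> K" if b: "coprime b M" for b
  proof (rule ccontr)
    assume bK: "b \<notin> K"
    \<comment> \<open>\<open>g\<close> is the indicator of \<open>K\<close> minus that of the
      translate \<open>{k. b * k \<in> K}\<close>. It is invariant under \<open>K\<close>, sums to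
      zero because \<open>b\<close> is a unit, and has \<open>g 1 = 1\<close>.\<close>
    define i where "i k = (if k \<in> K then 1 else 0 :: real)" for k
    define g where "g k = i k - i (b * k)" for k
    have i_per: "i (k + M) = i k" for k by (simp add: i_def K_per)
    have "g (k + M) = g k" for k
    proof -
      have "i (b * (k + M)) = i (b * k)"
        by (rule periodic_cong[of i M, OF i_per]) (simp add: cong_def distrib_left)
      then show ?thesis by (simp add: g_def i_per)
    qed
    moreover have "g k = 0" if "\<not> coprime k M" for k
      using that K_coprime[of k] K_coprime[of "b * k"] by (auto simp: g_def i_def)
    moreover have "(\<Sum>k<M. g k) = 0"
      using sum_periodic_mult[of i M b, OF i_per b M] by (simp add: g_def sum_subtractf)
    ultimately have g: "unit_periodic M g" by (simp add: unit_periodic_def)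
    have g_K: "g (c * (a * k)) = g (c * k)" if "a \<in> K" for a c k
      using K_mult[OF that, of "c * k"] K_mult[OF that, of "b * (c * k)"]
      by (simp add: g_def i_def mult_ac)
    \<comment> \<open>The values \<open>?h a\<close> agree for all \<open>a\<close> in
      \<open>K\<close>, so their weighted sum is \<open>?h 1 * ln N + O(1)\<close>. It is also O(1),
      whence \<open>?h 1 = 0\<close>.\<close>
    have L_zero: "L_one (\<lambda>k. g (c * k)) = 0" for c
    proof -
      let ?h = "\<lambda>a. L_one (\<lambda>k. g (c * (a * k)))"
      have "(\<lambda>N. ?h 1 * (\<Sum>a<M. prime_weight M a N) - (\<Sum>a<M. ?h a * prime_weight M a N)) \<in> O(\<lambda>_. 1)"
        by (rule K_weight_sum) (simp add: g_K)
      from sum_in_bigo(1)[OF this sum_L_one_prime_weight_bigo_1[OF unit_periodic_mult[OF g, of c]]]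
      have "(\<lambda>N. ?h 1 * (\<Sum>a<M. prime_weight M a N)) \<in> O(\<lambda>_. 1)" by simp
      moreover have "(\<lambda>N. ?h 1 * ((\<Sum>a<M. prime_weight M a N) - ln N)) \<in> O(\<lambda>_. 1)"
        using sum_prime_weight_bigo_1 by simp
      ultimately have "(\<lambda>N. ?h 1 * (\<Sum>a<M. prime_weight M a N)
          - ?h 1 * ((\<Sum>a<M. prime_weight M a N) - ln N)) \<in> O(\<lambda>_. 1)"
        by (rule sum_in_bigo(2))
      then have "(\<lambda>N. ?h 1 * ln (real N)) \<in> O(\<lambda>_. 1)" by (simp add: algebra_simps)
      from ln_not_bigo_1[OF this] show ?thesis by simp
    qed
    \<comment> \<open>Vanishing L-values make the weighted sum of \<open>g\<close> equal to
      \<open>- g 1 * ln N + O(1)\<close>, while concentration on \<open>K\<close> makes it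
      \<open>g 1 * ln N + O(1)\<close>. The comparison gives \<open>g 1 = 0\<close>.\<close>
    have 1: "(\<lambda>N. (\<Sum>a<M. g a * prime_weight M a N) + g 1 * ln (real N)) \<in> O(\<lambda>_. 1)"
      by (rule sum_prime_weight_of_L_one_zero[OF g L_zero])
    have 2: "(\<lambda>N. g 1 * (\<Sum>a<M. prime_weight M a N) - (\<Sum>a<M. g a * prime_weight M a N)) \<in> O(\<lambda>_. 1)"
      using g_K[of _ 1 1] by (intro K_weight_sum) simp
    have 3: "(\<lambda>N. - g 1 * ((\<Sum>a<M. prime_weight M a N) - ln N)) \<in> O(\<lambda>_. 1)"
      using sum_prime_weight_bigo_1 by simp
    have "(\<lambda>N. ((\<Sum>a<M. g a * prime_weight M a N) + g 1 * ln (real N))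
        + (g 1 * (\<Sum>a<M. prime_weight M a N) - (\<Sum>a<M. g a * prime_weight M a N))
        + - g 1 * ((\<Sum>a<M. prime_weight M a N) - ln N)) \<in> O(\<lambda>_. 1)"
      by (rule sum_in_bigo(1)[OF sum_in_bigo(1)[OF 1 2] 3])
    then have "(\<lambda>N. (2 * g 1) * ln (real N)) \<in> O(\<lambda>_. 1)" by (simp add: algebra_simps)
    from ln_not_bigo_1[OF this] have "g 1 = 0" by simp
    moreover have "1 \<in> K" by (simp add: K_def)
    ultimately show False using bK by (simp add: g_def i_def)
  qed
  have sign: "\<exists>s. s \<in> {-1, 1} \<and> (\<forall>c. F (a * c) = s * F c)" if "coprime a M" for a
    using coprime_K[OF that] unfolding K_def by force
  have "F 1 \<noteq> 0"
  proof
    assume "F 1 = 0"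
    moreover have "coprime k M" using nc[of k] Fk by blast
    then obtain s where "F (k * 1) = s * F 1" using sign by blast
    ultimately show False using Fk by simp
  qed
  define \<psi> where "\<psi> k = F k / F 1" for k
  have "\<psi> (a * b) = \<psi> a * \<psi> b \<and> \<psi> a \<in> {-1, 0, 1}" for a b
  proof (cases "coprime a M")
    case True
    then obtain s where s: "s \<in> {-1, 1}" "\<And>c. F (a * c) = s * F c" using sign by blast
    then show ?thesis using s(2)[of 1] \<open>F 1 \<noteq> 0\<close> by (auto simp: \<psi>_def)
  qed (auto simp: \<psi>_def nc)
  moreover have "\<psi> 1 = 1" using \<open>F 1 \<noteq> 0\<close> by (simp add: \<psi>_def)
  moreover have "unit_periodic M \<psi>"
    using F by (simp add: unit_periodic_def \<psi>_def sum_divide_distrib[symmetric])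
  then have "bounded_sums \<psi> (\<Sum>k<M. \<bar>\<psi> k\<bar>)"
    using unit_periodic_bounded_sums[of \<psi> 1] by simp
  ultimately have "L_one \<psi> \<noteq> 0"
    by (intro L_one_real_character_nonzero) auto
  moreover have "L_one \<psi> = L_one (\<lambda>k. F (1 * k)) / F 1"
  proof -
    have "summable (\<lambda>k. F (1 * Suc k) / Suc k)"
      by (rule summable_bounded_sums[OF unit_periodic_bounded_sums[OF F, of 1]])
    from suminf_divide[OF this, of "F 1"] show ?thesis
      by (simp add: L_one_def \<psi>_def divide_divide_eq_left mult.commute)
  qed
  ultimately show False using zero[of 1] by simp
qed

end

section \<open>Reduction of odd periodic functions to functions supported on units\<close>

lemma sum_odd_periodic_zero:
  fixes F :: "nat \<Rightarrow> real"
  assumes per: "\<And>k. F (k + M) = F k" and odd: "\<And>k l. M dvd k + l \<Longrightarrow> F l = - F k"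
  shows "(\<Sum>k<M. F k) = 0"
proof -
  have "(\<Sum>k<M. F k) = (\<Sum>k<M. F (M - Suc k))"
    by (rule sum.nat_diff_reindex[symmetric])
  also have "\<dots> = (\<Sum>k<M. - F (1 + k))"
    by (intro sum.cong refl odd) simp
  also have "\<dots> = - (\<Sum>k<M. F k)"
    using sum_periodic_shift[of F M 1, OF per] by (simp add: sum_negf)
  finally show ?thesis by simp
qed

lemma not_coprime_common_prime:
  fixes a b :: nat
  assumes "\<not> coprime a b"
  obtains p where "prime p" "p dvd a" "p dvd b"
proof -
  have "gcd a b \<noteq> 1" using assms coprime_iff_gcd_eq_1 by blast
  then obtain p where "prime p" "p dvd gcd a b" using prime_factor_nat by blast
  then show ?thesis using that by (meson dvd_trans gcd_dvd1 gcd_dvd2)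
qed

text \<open>\<open>gcd m (q ^ m)\<close> collects the full powers of the primes of \<open>m\<close>
  that divide \<open>q\<close>: the exponent \<open>m\<close> suffices because a multiplicity
  \<open>v\<close> of a prime \<open>p\<close> satisfies \<open>v < p ^ v \<le> m\<close>.\<close>

lemma coprime_part_decomposition:
  fixes m q :: nat
  assumes "m > 0"
  obtains M M' where "m = M * M'" "coprime q M" "M' dvd q ^ m"
proof
  define M' where "M' = gcd m (q ^ m)"
  define M where "M = m div M'"
  show m: "m = M * M'" by (simp add: M_def M'_def)
  show "M' dvd q ^ m" by (simp add: M'_def)
  show "coprime q M"
  proof (rule ccontr)
    assume "\<not> coprime q M"
    then obtain p where p: "prime p" "p dvd q" "p dvd M"
      by (rule not_coprime_common_prime)
    define v where "v = multiplicity p m"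
    have "v < p ^ v" using p prime_gt_1_nat by (simp add: power_gt_expt)
    also have "p ^ v \<le> m" using assms by (intro dvd_imp_le) (auto simp: v_def multiplicity_dvd)
    finally have "p ^ v dvd q ^ m"
      using p by (meson dvd_power_same dvd_trans le_imp_power_dvd less_imp_le)
    then have "p ^ v dvd M'" by (simp add: M'_def v_def multiplicity_dvd)
    then have "p * p ^ v dvd m" unfolding m using p by (intro mult_dvd_mono)
    then have "p ^ Suc v dvd m" by simp
    moreover have "\<not> p ^ Suc v dvd m"
      using assms p not_prime_unit[of p] by (subst power_dvd_iff_le_multiplicity) (auto simp: v_def)
    ultimately show False by blast
  qed
qed

text \<open>A counterexample with as few \<open>l\<close> as possible such that \<open>\<Phi>(l k)\<close> is not identically zero has a
  multiplicatively closed set \<open>t\<close> of such \<open>l\<close>. The primes outside \<open>t\<close> kill it and those inside can be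
  inverted, which leaves a function supported on residues prime to a divisor \<open>M\<close> of the period.\<close>

lemma odd_periodic_L_one_zero_imp_zero:
  fixes \<Phi> :: "nat \<Rightarrow> real"
  assumes m: "m > 0" and per: "\<And>k. \<Phi> (k + m) = \<Phi> k" and odd: "\<And>k l. m dvd k + l \<Longrightarrow> \<Phi> l = - \<Phi> k"
    and zero: "\<And>a. a > 0 \<Longrightarrow> L_one (\<lambda>k. \<Phi> (a * k)) = 0"
  shows "\<Phi> k = 0"
proof (rule ccontr)
  assume k: "\<Phi> k \<noteq> 0"
  define V where "V \<Phi> \<longleftrightarrow> (\<forall>k. \<Phi> (k + m) = \<Phi> k) \<and> (\<forall>k l. m dvd k + l \<longrightarrow> \<Phi> l = - \<Phi> k)
    \<and> (\<forall>a>0. L_one (\<lambda>k. \<Phi> (a * k)) = 0) \<and> (\<exists>k. \<Phi> k \<noteq> 0)" for \<Phi> :: "nat \<Rightarrow> real"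
  \<comment> \<open>Restricting to \<open>l < m\<close> makes the set finite and loses nothing for a
    function of period \<open>m\<close>, as only the residue of the multiplier matters.\<close>
  define T where "T \<Phi> = {l. l < m \<and> (\<exists>k. \<Phi> (l * k) \<noteq> 0)}" for \<Phi> :: "nat \<Rightarrow> real"
  have "V \<Phi>" using assms k by (auto simp: V_def)
  then obtain F where VF: "V F" and least: "\<And>\<Psi>. V \<Psi> \<Longrightarrow> card (T F) \<le> card (T \<Psi>)"
    using ex_has_least_nat[of V \<Phi> "\<lambda>\<Phi>. card (T \<Phi>)"] by blast
  have F_per: "F (k + m) = F k" and F_odd: "m dvd k + l \<Longrightarrow> F l = - F k"
    and F_zero: "a > 0 \<Longrightarrow> L_one (\<lambda>k. F (a * k)) = 0" for a k l
    using VF by (auto simp: V_def)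
  have F_cong: "F a = F b" if "[a = b] (mod m)" for a b
    by (rule periodic_cong[of F m, OF F_per that])
  define t where "t l \<longleftrightarrow> (\<exists>k. F (l * k) \<noteq> 0)" for l
  have t_cong: "t a \<longleftrightarrow> t b" if "[a = b] (mod m)" for a b
    using F_cong[OF cong_mult[OF that cong_refl]] by (simp add: t_def)
  have t_pos: "a > 0" if "t a" for a
    using that F_odd[of 0 0] by (cases "a = 0") (auto simp: t_def)
  have t_1: "t 1" using VF by (auto simp: t_def V_def)
  have t_multD: "t a" if "t (a * b)" for a b
    using that by (auto simp: t_def mult.assoc)
  \<comment> \<open>The dilation of \<open>F\<close> by \<open>a\<close> is again a counterexample,
    and its set of surviving multipliers lies in that of \<open>F\<close>. By minimality the two
    sets coincide, so \<open>b\<close> still survives after \<open>a\<close>.\<close>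
  have t_mult: "t (a * b)" if a: "t a" and b: "t b" for a b
  proof -
    define \<Psi> where "\<Psi> k = F (a * k)" for k
    have "V \<Psi>"
      unfolding V_def
    proof (intro conjI allI impI)
      show "\<Psi> (k + m) = \<Psi> k" for k
        unfolding \<Psi>_def by (rule F_cong) (simp add: cong_def distrib_left)
      show "\<Psi> l = - \<Psi> k" if "m dvd k + l" for k l
        unfolding \<Psi>_def using that by (intro F_odd) (simp flip: distrib_left)
      show "L_one (\<lambda>k. \<Psi> (c * k)) = 0" if "c > 0" for c
        using F_zero[of "a * c"] that t_pos[OF a] by (simp add: \<Psi>_def mult.assoc)
      show "\<exists>k. \<Psi> k \<noteq> 0" using a by (simp add: \<Psi>_def t_def)
    qed
    have sub: "T \<Psi> \<subseteq> T F"
      by (auto simp: T_def \<Psi>_def mult.left_commute[of a])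
    have "finite (T F)" by (simp add: T_def)
    from card_seteq[OF this sub least[OF \<open>V \<Psi>\<close>]] have "T \<Psi> = T F" .
    moreover have "t (b mod m)" using t_cong[of b "b mod m"] b by (simp add: cong_def)
    then have "b mod m \<in> T F" using m by (simp add: T_def t_def)
    ultimately have "b mod m \<in> T \<Psi>" by simp
    then have "t (a * (b mod m))" by (simp add: T_def \<Psi>_def t_def mult.assoc)
    then show ?thesis using t_cong[of "a * (b mod m)" "a * b"] by (simp add: cong_def mod_simps)
  qed
  have t_power: "t (a ^ n)" if "t a" for a n
    by (induction n) (use t_1 that t_mult in auto)
  define q where "q = \<Prod>{p. prime p \<and> p dvd m \<and> t p}"
  have fin: "finite {p. prime p \<and> p dvd m \<and> t p}"
    by (rule finite_subset[of _ "{p. p dvd m}"]) (use m in auto)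
  have "t (\<Prod>A)" if "finite A" "\<And>p. p \<in> A \<Longrightarrow> t p" for A
    using that by (induction A rule: finite_induct) (use t_1 t_mult in auto)
  then have t_q: "t q" unfolding q_def using fin by blast
  obtain M M' where M: "m = M * M'" "coprime q M" "M' dvd q ^ m"
    using coprime_part_decomposition[OF m] by blast
  have M_pos: "M > 0" using M m by (intro Nat.gr0I) auto
  \<comment> \<open>Dilation by \<open>e\<close> absorbs the factor \<open>M'\<close> and lowers the
    period from \<open>m\<close> to \<open>M\<close>; since \<open>e\<close> satisfies
    \<open>t\<close>, the dilated function is still nonzero.\<close>
  define e where "e = q ^ m"
  have t_e: "t e" unfolding e_def by (rule t_power[OF t_q])
  have "M' dvd e" using M(3) by (simp add: e_def)
  then have m_dvd: "m dvd M * e" unfolding M(1) by simp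
  have "unit_periodic M (\<lambda>k. F (e * k))"
    unfolding unit_periodic_def
  proof (intro conjI allI impI)
    show Fper: "F (e * (k + M)) = F (e * k)" for k
    proof (rule F_cong)
      have "[e * k + e * M = e * k + 0] (mod m)"
        using m_dvd by (intro cong_add cong_refl) (simp add: cong_0_iff mult.commute)
      then show "[e * (k + M) = e * k] (mod m)" by (simp add: distrib_left)
    qed
    show "F (e * k) = 0" if k: "\<not> coprime k M" for k
    proof (rule ccontr)
      assume nz: "F (e * k) \<noteq> 0"
      obtain p where p: "prime p" "p dvd k" "p dvd M"
        using k by (rule not_coprime_common_prime)
      obtain j where "k = p * j" using p by auto
      then have "t p" using nz unfolding t_def by (intro exI[of _ "e * j"]) (simp add: mult_ac)
      then have "p dvd q" unfolding q_def using p M fin by (intro dvd_prodI) auto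
      then show False using p M(2) by (meson coprime_common_divisor not_prime_unit)
    qed
    show "(\<Sum>k<M. F (e * k)) = 0"
    proof (rule sum_odd_periodic_zero[of "\<lambda>k. F (e * k)", OF Fper])
      show "F (e * l) = - F (e * k)" if "M dvd k + l" for k l
      proof (rule F_odd)
        have "M * e dvd (k + l) * e" using that by (intro mult_dvd_mono) auto
        then show "m dvd e * k + e * l" using m_dvd dvd_trans by (simp add: algebra_simps) blast
      qed
    qed
  qed
  moreover have "L_one (\<lambda>k. F (e * (d * k))) = 0" if "d > 0" for d
    using F_zero[of "e * d"] that t_pos[OF t_e] by (simp add: mult.assoc)
  ultimately have "F (e * k) = 0" for k
    by (rule unit_periodic_L_one_zero_imp_zero[OF M_pos])
  then show False using t_e by (simp add: t_def)
qed

section \<open>The sawtooth function\<close>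

text \<open>The periodic first Bernoulli function. The value 0 at integers makes it odd and equal to
  its Fourier series everywhere.\<close>

definition sawtooth :: "real \<Rightarrow> real" where
  "sawtooth t = (if t \<in> \<int> then 0 else frac t - 1 / 2)"

lemma sin_add_2pi_Ints: "n \<in> \<int> \<Longrightarrow> sin (x + 2 * pi * n) = sin x"
  by (simp add: sin_add sin_integer_2pi cos_integer_2pi)

lemma
  assumes t: "real m * t \<in> \<int>"
  shows sin_multiple_periodic: "sin (2 * pi * real (k + m) * t) = sin (2 * pi * real k * t)"
    and sin_multiple_odd: "m dvd k + l \<Longrightarrow> sin (2 * pi * real l * t) = - sin (2 * pi * real k * t)"
proof -
  show "sin (2 * pi * real (k + m) * t) = sin (2 * pi * real k * t)"
    using sin_add_2pi_Ints[OF t, of "2 * pi * real k * t"] by (simp add: algebra_simps)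
  assume "m dvd k + l"
  then obtain q where q: "k + l = m * q" by blast
  have "real q * (real m * t) \<in> \<int>" by (rule Ints_mult[OF _ t]) simp
  moreover have "real l * t = real q * (real m * t) - real k * t"
    using arg_cong[OF q, of real] by (simp add: algebra_simps flip: distrib_left)
  then have "2 * pi * real l * t = - (2 * pi * real k * t) + 2 * pi * (real q * (real m * t))"
    by (simp only: mult.assoc) (simp add: algebra_simps)
  ultimately show "sin (2 * pi * real l * t) = - sin (2 * pi * real k * t)"
    using sin_add_2pi_Ints[of "real q * (real m * t)" "- (2 * pi * real k * t)"] by simp
qed

lemma bounded_sums_sin:
  assumes "m > 0" "real m * t \<in> \<int>"
  shows "\<exists>C. bounded_sums (\<lambda>k. sin (2 * pi * real k * t)) C"
  using bounded_sums_periodic[of "\<lambda>k. sin (2 * pi * real k * t)" m] assms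
    sum_odd_periodic_zero[of "\<lambda>k. sin (2 * pi * real k * t)" m]
    sin_multiple_periodic[OF assms(2)] sin_multiple_odd[OF assms(2)] by blast

text \<open>\<open>1 - cis \<theta>\<close> has modulus \<open>2 * sin (\<theta> / 2)\<close> and
  argument \<open>(\<theta> - pi) / 2\<close>, which lies in the principal range.\<close>

lemma Ln_one_minus_cis:
  assumes "0 < \<theta>" "\<theta> < 2 * pi"
  shows "Im (Ln (1 - cis \<theta>)) = (\<theta> - pi) / 2"
proof -
  define s where "s = 2 * sin (\<theta> / 2)"
  have s: "s > 0" unfolding s_def using assms by (simp add: sin_gt_zero)
  have "1 - cis \<theta> = of_real s * cis ((\<theta> - pi) / 2)"
  proof (rule complex_eqI)
    have h: "cos ((\<theta> - pi) / 2) = sin (\<theta> / 2)" "sin ((\<theta> - pi) / 2) = - cos (\<theta> / 2)"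
      using sin_cos_eq[of "\<theta> / 2"] cos_sin_eq[of "\<theta> / 2"] cos_minus[of "pi / 2 - \<theta> / 2"] sin_minus[of "pi / 2 - \<theta> / 2"]
      by (simp_all add: diff_divide_distrib)
    show "Re (1 - cis \<theta>) = Re (of_real s * cis ((\<theta> - pi) / 2))"
      using cos_double_sin[of "\<theta> / 2"] by (simp add: h s_def power2_eq_square)
    show "Im (1 - cis \<theta>) = Im (of_real s * cis ((\<theta> - pi) / 2))"
      using sin_double[of "\<theta> / 2"] by (simp add: h s_def)
  qed
  also have "\<dots> = exp (Complex (ln s) ((\<theta> - pi) / 2))"
    using s by (simp add: exp_eq_polar)
  also have "Ln \<dots> = Complex (ln s) ((\<theta> - pi) / 2)"
    using assms by (intro Ln_exp) auto
  finally show ?thesis by simp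
qed

text \<open>Abel's limit theorem: for \<open>0 < r < 1\<close> the series of \<open>Ln\<close> gives
  the value \<open>A r\<close>, and the error after \<open>N\<close> terms is at most
  \<open>C / Suc N\<close> uniformly in \<open>r\<close>. Hence \<open>r\<close> may tend to 1
  before \<open>N\<close> tends to infinity.\<close>

lemma L_one_sin_eq_Ln:
  assumes bs: "bounded_sums (\<lambda>k. sin (real k * \<theta>)) C" and \<theta>: "0 < \<theta>" "\<theta> < 2 * pi"
  shows "L_one (\<lambda>k. sin (real k * \<theta>)) = - Im (Ln (1 - cis \<theta>))"
proof -
  define z where "z = cis \<theta>"
  let ?F = "\<lambda>k. sin (real k * \<theta>)"
  define A where "A r = - Im (Ln (1 - of_real r * z))" for r :: real
  define P where "P N r = (\<Sum>k<N. ?F (Suc k) / Suc k * r ^ Suc k)" for N and r :: real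
  have C: "0 \<le> C" by (rule bounded_sums_nonneg[OF bs])
  have sums: "(\<lambda>k. ?F (Suc k) / Suc k * r ^ Suc k) sums A r" if r: "0 < r" "r < 1" for r
  proof -
    have "(\<lambda>n. - ((- (- of_real r * z)) ^ n) / of_nat n) sums Ln (1 + (- of_real r * z))"
      using r by (intro Ln_series') (simp add: z_def norm_mult)
    from sums_minus[OF sums_Im[OF this]]
    have "(\<lambda>n. ?F n / n * r ^ n) sums A r"
      by (simp add: A_def z_def power_mult_distrib Complex.DeMoivre Im_divide_of_nat mult.commute flip: of_real_power)
    from sums_split_initial_segment[OF this, of 1] show ?thesis by simp
  qed
  have approx: "\<bar>A r - P N r\<bar> \<le> C / Suc N" if r: "0 < r" "r < 1" for r N
  proof -
    have "(\<lambda>n. \<bar>P (n + N) r - P N r\<bar>) \<longlonglongrightarrow> \<bar>A r - P N r\<bar>"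
      using sums[OF r] unfolding sums_def P_def[symmetric]
      by (intro tendsto_intros LIMSEQ_ignore_initial_segment)
    moreover have "\<bar>P (n + N) r - P N r\<bar> \<le> C / Suc N" for n
    proof -
      have "P (n + N) r - P N r = (\<Sum>k<n. ?F (Suc N + k) * (r ^ (Suc N + k) / (Suc N + k)))"
        by (induction n) (simp_all add: P_def add_ac)
      also have "\<bar>\<dots>\<bar> \<le> C * (r ^ (Suc N + 0) / (Suc N + 0))"
      proof (rule summation_by_parts_bound)
        show "\<bar>\<Sum>k<n. ?F (Suc N + k)\<bar> \<le> C" for n
          using bs unfolding bounded_sums_def by blast
        show "r ^ (Suc N + Suc k) / (Suc N + Suc k) \<le> r ^ (Suc N + k) / (Suc N + k)" for k
          using r by (intro frac_le power_decreasing) auto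
      qed (use r in simp)
      also have "\<dots> \<le> C * (1 / Suc N)"
        using r C power_le_one[of r "Suc N"] by (intro mult_left_mono) (auto intro: divide_right_mono)
      finally show ?thesis by simp
    qed
    ultimately show ?thesis by (intro LIMSEQ_le_const2) auto
  qed
  have "\<bar>A 1 - P N 1\<bar> \<le> C / Suc N" for N
  proof -
    have "Re z < 1"
    proof (rule ccontr)
      assume "\<not> Re z < 1"
      then have "cos \<theta> = 1" using cos_le_one[of \<theta>] by (simp add: z_def)
      then obtain n :: int where "\<theta> = of_int n * 2 * pi" using cos_one_2pi_int[of \<theta>] by auto
      with \<theta> have "0 < n" "n < 1"
        by (auto simp: zero_less_mult_iff)
      then show False by simp
    qed
    \<comment> \<open>The real part of \<open>1 - z\<close> is positive, so the point avoids the
      branch cut and \<open>A\<close> is continuous at 1.\<close>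
    then have nn: "1 - of_real 1 * z \<notin> \<real>\<^sub>\<le>\<^sub>0" by (simp add: complex_nonpos_Reals_iff)
    have "((\<lambda>r. \<bar>A r - P N r\<bar>) \<longlongrightarrow> \<bar>A 1 - P N 1\<bar>) (at_left 1)"
      unfolding A_def P_def using nn by (intro tendsto_intros)
    moreover have "\<forall>\<^sub>F r in at_left (1::real). \<bar>A r - P N r\<bar> \<le> C / Suc N"
      using eventually_at_left_real[of 0 "1::real"]
    proof (rule eventually_mono)
      show "\<bar>A r - P N r\<bar> \<le> C / Suc N" if "r \<in> {0<..<1}" for r
        using that approx by simp
    qed simp
    ultimately show ?thesis
      by (intro tendsto_upperbound) (auto simp: trivial_limit_at_left_real)
  qed
  moreover have "P N 1 = (\<Sum>k=1..N. ?F k / k)" for N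
    unfolding P_def sum_atLeast1_lessThan by simp
  ultimately have P: "\<bar>A 1 - (\<Sum>k=1..N. ?F k / k)\<bar> \<le> C / Suc N" for N by metis
  have "\<bar>A 1 - L_one ?F\<bar> \<le> C / Suc N + C / Suc N" for N
    using P[of N] L_one_approx[OF bs, of N] by linarith
  then have "\<bar>A 1 - L_one ?F\<bar> \<le> 2 * C / Suc N" for N by simp
  moreover have "(\<lambda>N. 2 * C / Suc N) \<longlonglongrightarrow> 0"
    using LIMSEQ_Suc[OF lim_const_over_n[of "2 * C"]] by simp
  ultimately have "\<bar>A 1 - L_one ?F\<bar> \<le> 0" by (intro LIMSEQ_le_const) auto
  then show ?thesis by (simp add: A_def z_def)
qed

lemma L_one_sin:
  assumes "m > 0" "real m * t \<in> \<int>"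
  shows "L_one (\<lambda>k. sin (2 * pi * real k * t)) = - pi * sawtooth t"
proof (cases "t \<in> \<int>")
  case True
  then have "sin (2 * pi * real k * t) = 0" for k
    using sin_add_2pi_Ints[of "real k * t" 0] by (simp add: mult.assoc)
  then show ?thesis using True by (simp add: L_one_def sawtooth_def)
next
  case False
  define \<theta> where "\<theta> = 2 * pi * frac t"
  have "0 < frac t" "frac t < 1" using False frac_lt_1[of t] by (auto simp: frac_gt_0_iff)
  then have \<theta>: "0 < \<theta>" "\<theta> < 2 * pi" by (auto simp: \<theta>_def)
  have "sin (real k * \<theta>) = sin (2 * pi * real k * t)" for k
    using sin_add_2pi_Ints[of "real k * of_int \<lfloor>t\<rfloor>" "real k * \<theta>"]
    by (simp add: \<theta>_def frac_def algebra_simps)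
  then have eq: "(\<lambda>k. sin (2 * pi * real k * t)) = (\<lambda>k. sin (real k * \<theta>))" by simp
  obtain C where "bounded_sums (\<lambda>k. sin (real k * \<theta>)) C"
    using bounded_sums_sin[OF assms] unfolding eq by blast
  from L_one_sin_eq_Ln[OF this \<theta>] show ?thesis
    using Ln_one_minus_cis[OF \<theta>] False unfolding eq
    by (simp add: sawtooth_def \<theta>_def field_simps)
qed

section \<open>Subgroups containing the integer lattice\<close>

text \<open>The representative of a coset of \<open>Zn\<close> in the cube. It lets sums over
  \<open>H \<inter> half_open_cube\<close> serve as sums over the finite group
  \<open>H / Zn\<close>.\<close>

definition frac_vec :: "real ^ 'n \<Rightarrow> real ^ 'n" where
  "frac_vec x = (\<chi> i. frac (x $ i))"

lemma frac_vec_in_cube: "frac_vec x \<in> half_open_cube"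
  by (simp add: frac_vec_def half_open_cube_def frac_lt_1)

lemma frac_vec_cube: "x \<in> half_open_cube \<Longrightarrow> frac_vec x = x"
  by (simp add: frac_vec_def half_open_cube_def vec_eq_iff frac_eq)

lemma frac_vec_diff_Zn: "frac_vec x - x \<in> Zn"
  by (simp add: frac_vec_def Zn_def frac_def)

lemma frac_vec_cong: "x - y \<in> Zn \<Longrightarrow> frac_vec x = frac_vec y"
proof -
  assume "x - y \<in> Zn"
  then have "frac (x $ i) = frac (y $ i)" for i
  proof -
    obtain n where "x $ i - y $ i = of_int n"
      using \<open>x - y \<in> Zn\<close> by (auto simp: Zn_def elim: Ints_cases)
    then have "x $ i = y $ i + of_int n" by simp
    then show ?thesis by (simp add: frac_def)
  qed
  then show ?thesis by (simp add: frac_vec_def)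
qed

lemma coordinate_Zn: "z \<in> Zn \<Longrightarrow> z $ i \<in> \<int>"
  by (simp add: Zn_def)

text \<open>A common setting for the lattice and for its coordinate kernels, so that orthogonality
  is available in each of them.\<close>

locale integral_subgroup =
  fixes H :: "(real ^ 'n) set"
  assumes zero_mem: "0 \<in> H" and add_mem: "x \<in> H \<Longrightarrow> y \<in> H \<Longrightarrow> x + y \<in> H"
    and uminus_mem: "x \<in> H \<Longrightarrow> - x \<in> H" and Zn_subset: "Zn \<subseteq> H"
    and finite_cube: "finite (H \<inter> half_open_cube)"
begin

lemma frac_vec_mem: "frac_vec x \<in> H" if "x \<in> H"
  using add_mem[OF that subsetD[OF Zn_subset frac_vec_diff_Zn[of x]]] by simp

lemma multiple_mem: "real k *\<^sub>R x \<in> H" if "x \<in> H"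
  by (induction k) (use that zero_mem add_mem in \<open>auto simp: scaleR_left_distrib add.commute\<close>)

text \<open>Translation by \<open>y\<close> followed by reduction into the cube permutes the
  representatives, with translation by \<open>- y\<close> as inverse.\<close>

lemma sum_cube_translate:
  assumes per: "\<And>x z. z \<in> Zn \<Longrightarrow> f (x + z) = f x" and y: "y \<in> H"
  shows "(\<Sum>x\<in>H \<inter> half_open_cube. f (x + y)) = (\<Sum>x\<in>H \<inter> half_open_cube. f x)"
proof (rule sum.reindex_bij_witness[of _ "\<lambda>x. frac_vec (x - y)" "\<lambda>x. frac_vec (x + y)"])
  fix x assume x: "x \<in> H \<inter> half_open_cube"
  have "frac_vec (x + y) - y - x \<in> Zn" "frac_vec (x - y) + y - x \<in> Zn"
    using frac_vec_diff_Zn[of "x + y"] frac_vec_diff_Zn[of "x - y"] by (simp_all add: algebra_simps)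
  from frac_vec_cong[OF this(1)] frac_vec_cong[OF this(2)]
  show "frac_vec (frac_vec (x + y) - y) = x" "frac_vec (frac_vec (x - y) + y) = x"
    using x by (simp_all add: frac_vec_cube)
  show "frac_vec (x + y) \<in> H \<inter> half_open_cube" "frac_vec (x - y) \<in> H \<inter> half_open_cube"
    using x y add_mem[of x "- y"] add_mem[of x y] uminus_mem[of y]
    by (simp_all add: frac_vec_mem frac_vec_in_cube)
  show "f (frac_vec (x + y)) = f (x + y)"
    using per[OF frac_vec_diff_Zn[of "x + y"], of "x + y"] by simp
qed

lemma card_cube_pos: "card (H \<inter> half_open_cube) > 0"
  using finite_cube zero_mem by (auto simp: card_gt_0_iff half_open_cube_def)

text \<open>A form of Lagrange's theorem. Translation by \<open>y\<close> preserves the sum of the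
  fractional parts, so the order of the group times \<open>y $ i\<close> is a difference of sums of
  floors.\<close>

lemma card_cube_multiple: "real (card (H \<inter> half_open_cube)) * y $ i \<in> \<int>" if "y \<in> H"
proof -
  have "(\<Sum>x\<in>H \<inter> half_open_cube. frac ((x + y) $ i)) = (\<Sum>x\<in>H \<inter> half_open_cube. frac (x $ i))"
  proof (rule sum_cube_translate[OF _ that])
    fix x z :: "real ^ 'n" assume "z \<in> Zn"
    then show "frac ((x + z) $ i) = frac (x $ i)"
      using frac_vec_cong[of "x + z" x] by (simp add: frac_vec_def vec_eq_iff)
  qed
  then have "real (card (H \<inter> half_open_cube)) * y $ i
      = (\<Sum>x\<in>H \<inter> half_open_cube. of_int \<lfloor>(x + y) $ i\<rfloor>) - (\<Sum>x\<in>H \<inter> half_open_cube. of_int \<lfloor>x $ i\<rfloor>)"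
    by (simp add: frac_def sum_subtractf sum.distrib algebra_simps)
  also have "\<dots> \<in> \<int>" by (intro Ints_diff Ints_sum) auto
  finally show ?thesis .
qed

text \<open>Translation by some \<open>y\<close> with \<open>\<phi> y\<close> not integral
  multiplies the complex character sum by a factor other than 1, so the sum is zero; the cosine sum
  is its real part.\<close>

lemma character_orthogonality:
  assumes add: "\<And>x y. \<phi> (x + y) = \<phi> x + \<phi> y" and int: "\<And>z. z \<in> Zn \<Longrightarrow> \<phi> z \<in> \<int>"
  shows "(\<Sum>x\<in>H \<inter> half_open_cube. cos (2 * pi * \<phi> x))
    = (if \<forall>x\<in>H. \<phi> x \<in> \<int> then real (card (H \<inter> half_open_cube)) else 0)"
proof (cases "\<forall>x\<in>H. \<phi> x \<in> \<int>")
  case True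
  then show ?thesis by (simp add: cos_integer_2pi)
next
  case False
  then obtain y where y: "y \<in> H" "\<phi> y \<notin> \<int>" by blast
  define S where "S = (\<Sum>x\<in>H \<inter> half_open_cube. cis (2 * pi * \<phi> x))"
  have cis_add: "cis (2 * pi * \<phi> (x + y)) = cis (2 * pi * \<phi> x) * cis (2 * pi * \<phi> y)" for x y
    by (simp add: add distrib_left cis_mult)
  have "S = (\<Sum>x\<in>H \<inter> half_open_cube. cis (2 * pi * \<phi> (x + y)))"
    unfolding S_def using y int by (intro sum_cube_translate[symmetric]) (simp_all add: cis_add cis_multiple_2pi)
  also have "\<dots> = cis (2 * pi * \<phi> y) * S"
    unfolding cis_add S_def sum_distrib_right[symmetric] by (rule mult.commute)
  finally have "(1 - cis (2 * pi * \<phi> y)) * S = 0" by (simp add: algebra_simps)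
  moreover have "cis (2 * pi * \<phi> y) \<noteq> 1"
  proof
    assume "cis (2 * pi * \<phi> y) = 1"
    then have "cos (2 * pi * \<phi> y) = 1" by (simp add: complex_eq_iff)
    then show False using y(2) by (auto simp: cos_one_2pi_int)
  qed
  ultimately have "S = 0" by simp
  moreover have "Re S = (\<Sum>x\<in>H \<inter> half_open_cube. cos (2 * pi * \<phi> x))" by (simp add: S_def)
  ultimately have "(\<Sum>x\<in>H \<inter> half_open_cube. cos (2 * pi * \<phi> x)) = 0" by simp
  then show ?thesis using False by (simp only: if_False)
qed

end

section \<open>Necessity of the class sums by Fourier analysis on the finite quotient\<close>

lemma L_one_sum:
  assumes "finite A" "\<And>a. a \<in> A \<Longrightarrow> summable (\<lambda>k. F a (Suc k) / Suc k)"
  shows "L_one (\<lambda>k. \<Sum>a\<in>A. c a * F a k) = (\<Sum>a\<in>A. c a * L_one (F a))"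
proof -
  have "(\<Sum>k. \<Sum>a\<in>A. c a * (F a (Suc k) / Suc k)) = (\<Sum>a\<in>A. \<Sum>k. c a * (F a (Suc k) / Suc k))"
    using assms by (intro suminf_sum summable_mult)
  also have "\<dots> = (\<Sum>a\<in>A. c a * L_one (F a))"
    using assms by (intro sum.cong refl) (simp only: L_one_def suminf_mult)
  finally show ?thesis by (simp add: L_one_def sum_divide_distrib)
qed

context integral_subgroup
begin

definition coord_kernel :: "'n \<Rightarrow> (real ^ 'n) set" where
  "coord_kernel i = {x \<in> H. x $ i \<in> \<int>}"

lemma integral_subgroup_coord_kernel: "integral_subgroup (coord_kernel i)"
proof
  show "finite (coord_kernel i \<inter> half_open_cube)"
    by (rule finite_subset[OF _ finite_cube]) (auto simp: coord_kernel_def)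
  show "Zn \<subseteq> coord_kernel i" using Zn_subset by (auto simp: coord_kernel_def Zn_def)
qed (use zero_mem add_mem uminus_mem in \<open>auto simp: coord_kernel_def\<close>)

text \<open>Tested against \<open>cos (2 * pi * x $ j)\<close>, the sum over all of \<open>H\<close>
  vanishes by nontriviality, and the sum over \<open>coord_kernel i\<close> is its order or 0
  according to whether it lies in \<open>coord_kernel j\<close>. The resulting system is triangular
  for inclusion, with positive diagonal.\<close>

lemma kernel_sums_zero:
  fixes u :: "real ^ 'n"
  assumes nontrivial: "\<And>i. coord_kernel i \<noteq> H"
    and even: "\<And>x. x \<in> H \<Longrightarrow> (\<Sum>i\<in>UNIV. u $ i * (if x $ i \<in> \<int> then 0 else 1)) = 0"
  shows "(\<Sum>i | coord_kernel i = coord_kernel j. u $ i) = 0"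
proof -
  define c where "c X = real (card (X \<inter> half_open_cube))" for X :: "(real ^ 'n) set"
  have c_pos: "c (coord_kernel i) > 0" for i
    unfolding c_def using integral_subgroup.card_cube_pos[OF integral_subgroup_coord_kernel[of i]] by simp
  have incl: "(\<Sum>i | coord_kernel i \<subseteq> coord_kernel j. u $ i * c (coord_kernel i)) = 0" for j
  proof -
    let ?G = "H \<inter> half_open_cube"
    have K: "(\<Sum>x\<in>?G. (if x $ i \<in> \<int> then 0 else 1) * cos (2 * pi * x $ j))
        = - (if coord_kernel i \<subseteq> coord_kernel j then c (coord_kernel i) else 0)" for i
    proof -
      have "(\<Sum>x\<in>?G. (if x $ i \<in> \<int> then 0 else 1) * cos (2 * pi * x $ j))
          = (\<Sum>x\<in>?G. cos (2 * pi * x $ j)) - (\<Sum>x\<in>?G. if x $ i \<in> \<int> then cos (2 * pi * x $ j) else 0)"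
        unfolding sum_subtractf[symmetric] by (intro sum.cong) auto
      also have "(\<Sum>x\<in>?G. if x $ i \<in> \<int> then cos (2 * pi * x $ j) else 0)
          = (\<Sum>x\<in>coord_kernel i \<inter> half_open_cube. cos (2 * pi * x $ j))"
        using finite_cube by (intro sum.mono_neutral_cong_right) (auto simp: coord_kernel_def)
      also have "\<dots> = (if coord_kernel i \<subseteq> coord_kernel j then c (coord_kernel i) else 0)"
        using integral_subgroup.character_orthogonality[OF integral_subgroup_coord_kernel[of i], of "\<lambda>x. x $ j"]
        by (auto simp: coordinate_Zn c_def coord_kernel_def)
      also have "(\<Sum>x\<in>?G. cos (2 * pi * x $ j)) = 0"
        using character_orthogonality[of "\<lambda>x. x $ j"] nontrivial[of j]
        by (auto simp: coordinate_Zn coord_kernel_def)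
      finally show ?thesis by simp
    qed
    have "0 = (\<Sum>x\<in>?G. (\<Sum>i\<in>UNIV. u $ i * (if x $ i \<in> \<int> then 0 else 1)) * cos (2 * pi * x $ j))"
      using even by simp
    also have "\<dots> = (\<Sum>x\<in>?G. \<Sum>i\<in>UNIV. u $ i * ((if x $ i \<in> \<int> then 0 else 1) * cos (2 * pi * x $ j)))"
      by (simp only: sum_distrib_right mult.assoc)
    also have "\<dots> = (\<Sum>i\<in>UNIV. u $ i * (\<Sum>x\<in>?G. (if x $ i \<in> \<int> then 0 else 1) * cos (2 * pi * x $ j)))"
      by (subst sum.swap) (simp only: sum_distrib_left)
    also have "\<dots> = - (\<Sum>i\<in>UNIV. if coord_kernel i \<subseteq> coord_kernel j then u $ i * c (coord_kernel i) else 0)"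
      unfolding K sum_negf[symmetric] by (intro sum.cong) auto
    finally show ?thesis by (simp add: sum.If_cases)
  qed
  show ?thesis
  proof (induction "card {i. coord_kernel i \<subset> coord_kernel j}" arbitrary: j rule: less_induct)
    case less
    \<comment> \<open>The factor \<open>c\<close> is constant on indices with the same kernel, so
      grouping by kernel lets the induction hypothesis remove all strictly smaller kernels.\<close>
    have "(\<Sum>i | coord_kernel i \<subset> coord_kernel j. u $ i * c (coord_kernel i))
        = (\<Sum>X\<in>coord_kernel ` {i. coord_kernel i \<subset> coord_kernel j}.
            \<Sum>i | i \<in> {i. coord_kernel i \<subset> coord_kernel j} \<and> coord_kernel i = X. u $ i * c (coord_kernel i))"
      by (rule sum.image_gen) simp
    also have "\<dots> = 0"
    proof (rule sum.neutral, rule ballI)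
      fix X assume "X \<in> coord_kernel ` {i. coord_kernel i \<subset> coord_kernel j}"
      then obtain l where l: "X = coord_kernel l" "coord_kernel l \<subset> coord_kernel j" by auto
      have "card {i. coord_kernel i \<subset> coord_kernel l} < card {i. coord_kernel i \<subset> coord_kernel j}"
        using l by (intro psubset_card_mono) auto
      from less[OF this] have 0: "(\<Sum>i | coord_kernel i = coord_kernel l. u $ i) = 0" .
      have "(\<Sum>i | i \<in> {i. coord_kernel i \<subset> coord_kernel j} \<and> coord_kernel i = X. u $ i * c (coord_kernel i))
          = (\<Sum>i | coord_kernel i = coord_kernel l. u $ i * c (coord_kernel l))"
        using l by (intro sum.cong) auto
      also have "\<dots> = 0" using 0 by (simp flip: sum_distrib_right)
      finally show "(\<Sum>i | i \<in> {i. coord_kernel i \<subset> coord_kernel j} \<and> coord_kernel i = X. u $ i * c (coord_kernel i)) = 0" .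
    qed
    finally have "(\<Sum>i | coord_kernel i \<subset> coord_kernel j. u $ i * c (coord_kernel i)) = 0" .
    moreover have "{i. coord_kernel i \<subseteq> coord_kernel j}
        = {i. coord_kernel i = coord_kernel j} \<union> {i. coord_kernel i \<subset> coord_kernel j}" by auto
    ultimately have "(\<Sum>i | coord_kernel i = coord_kernel j. u $ i * c (coord_kernel i)) = 0"
      using incl[of j] by (simp add: sum.union_disjoint disjoint_iff)
    then have "(\<Sum>i | coord_kernel i = coord_kernel j. u $ i) * c (coord_kernel j) = 0"
      by (simp add: sum_distrib_right)
    then show ?case using c_pos[of j] by simp
  qed
qed

text \<open>For the odd periodic \<open>\<Phi>\<close>, the value of \<open>L_one\<close> at a
  dilation by \<open>a\<close> is a combination of sawtooth sums at the points
  \<open>a *\<^sub>R x\<close> of \<open>H\<close>, which vanish. Hence \<open>\<Phi> 1 = 0\<close>,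
  while orthogonality evaluates \<open>\<Phi> 1\<close> as \<open>m / 2\<close> times the difference
  of the two sides.\<close>

lemma opposite_sums_equal:
  fixes u :: "real ^ 'n"
  assumes odd: "\<And>x. x \<in> H \<Longrightarrow> (\<Sum>i\<in>UNIV. u $ i * sawtooth (x $ i)) = 0"
  shows "(\<Sum>i | \<forall>x\<in>H. x $ i - x $ j \<in> \<int>. u $ i) = (\<Sum>i | \<forall>x\<in>H. x $ i + x $ j \<in> \<int>. u $ i)"
proof -
  let ?G = "H \<inter> half_open_cube"
  define m where "m = card ?G"
  have m: "m > 0" unfolding m_def by (rule card_cube_pos)
  have mx: "real m * x $ i \<in> \<int>" if "x \<in> H" for x i
    unfolding m_def using that by (rule card_cube_multiple)
  define \<Phi> where "\<Phi> k = (\<Sum>(x, i)\<in>?G \<times> UNIV. (u $ i * sin (2 * pi * x $ j)) * sin (2 * pi * real k * x $ i))" for k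
  have "\<Phi> 1 = 0"
  proof (rule odd_periodic_L_one_zero_imp_zero[OF m])
    show "\<Phi> (k + m) = \<Phi> k" for k
      unfolding \<Phi>_def by (intro sum.cong refl) (auto simp: sin_multiple_periodic[OF mx] simp del: of_nat_add)
    show "\<Phi> l = - \<Phi> k" if "m dvd k + l" for k l
      unfolding \<Phi>_def sum_negf[symmetric]
      by (intro sum.cong refl) (auto simp: sin_multiple_odd[OF mx that])
    fix a :: nat assume "a > 0"
    have ax: "real m * (real a * x $ i) \<in> \<int>" if "x \<in> H" for x i
      using mx[OF multiple_mem[OF that, of a], of i] by simp
    have "L_one (\<lambda>k. \<Phi> (a * k))
        = L_one (\<lambda>k. \<Sum>p\<in>?G \<times> UNIV. (u $ snd p * sin (2 * pi * fst p $ j)) * sin (2 * pi * real k * (real a * fst p $ snd p)))"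
      unfolding \<Phi>_def by (simp add: split_beta mult_ac)
    also have "\<dots> = (\<Sum>p\<in>?G \<times> UNIV. (u $ snd p * sin (2 * pi * fst p $ j))
        * L_one (\<lambda>k. sin (2 * pi * real k * (real a * fst p $ snd p))))"
    proof (rule L_one_sum)
      fix p :: "(real ^ 'n) \<times> 'n" assume "p \<in> ?G \<times> UNIV"
      then show "summable (\<lambda>k. sin (2 * pi * real (Suc k) * (real a * fst p $ snd p)) / real (Suc k))"
        using bounded_sums_sin[OF m ax, of "fst p" "snd p"]
          summable_bounded_sums[of "\<lambda>k. sin (2 * pi * real k * (real a * fst p $ snd p))"]
        by auto
    qed (use finite_cube in simp)
    also have "\<dots> = (\<Sum>p\<in>?G \<times> UNIV. (u $ snd p * sin (2 * pi * fst p $ j))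
        * (- pi * sawtooth (real a * fst p $ snd p)))"
      by (intro sum.cong refl) (auto simp: L_one_sin[OF m ax])
    also have "\<dots> = (\<Sum>(x, i)\<in>?G \<times> UNIV. - pi * sin (2 * pi * x $ j) * (u $ i * sawtooth ((real a *\<^sub>R x) $ i)))"
      by (intro sum.cong refl) auto
    also have "\<dots> = (\<Sum>x\<in>?G. \<Sum>i\<in>UNIV. - pi * sin (2 * pi * x $ j) * (u $ i * sawtooth ((real a *\<^sub>R x) $ i)))"
      by (rule sum.cartesian_product[symmetric])
    also have "\<dots> = (\<Sum>x\<in>?G. - pi * sin (2 * pi * x $ j)
        * (\<Sum>i\<in>UNIV. u $ i * sawtooth ((real a *\<^sub>R x) $ i)))"
      by (simp only: sum_distrib_left)
    also have "\<dots> = 0"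
    proof (intro sum.neutral ballI)
      fix x assume "x \<in> ?G"
      then show "- pi * sin (2 * pi * x $ j) * (\<Sum>i\<in>UNIV. u $ i * sawtooth ((real a *\<^sub>R x) $ i)) = 0"
        using odd[OF multiple_mem[of x a]] by simp
    qed
    finally show "L_one (\<lambda>k. \<Phi> (a * k)) = 0" .
  qed
  moreover have "\<Phi> 1 = (\<Sum>i\<in>UNIV. u $ i * (\<Sum>x\<in>?G. sin (2 * pi * x $ i) * sin (2 * pi * x $ j)))"
    unfolding \<Phi>_def sum.cartesian_product[symmetric]
    by (subst sum.swap) (simp add: sum_distrib_left mult_ac)
  \<comment> \<open>The product of sines becomes a difference of cosines of the characters
    \<open>x $ i - x $ j\<close> and \<open>x $ i + x $ j\<close>, each of which is summed by
    orthogonality.\<close>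
  moreover have "(\<Sum>x\<in>?G. sin (2 * pi * x $ i) * sin (2 * pi * x $ j))
      = m / 2 * ((if \<forall>x\<in>H. x $ i - x $ j \<in> \<int> then 1 else 0) - (if \<forall>x\<in>H. x $ i + x $ j \<in> \<int> then 1 else 0))" for i
  proof -
    have "(\<Sum>x\<in>?G. sin (2 * pi * x $ i) * sin (2 * pi * x $ j))
        = (\<Sum>x\<in>?G. cos (2 * pi * (x $ i - x $ j)) / 2 - cos (2 * pi * (x $ i + x $ j)) / 2)"
      by (intro sum.cong refl) (simp add: sin_times_sin right_diff_distrib distrib_left diff_divide_distrib)
    also have "\<dots> = (\<Sum>x\<in>?G. cos (2 * pi * (x $ i - x $ j))) / 2 - (\<Sum>x\<in>?G. cos (2 * pi * (x $ i + x $ j))) / 2"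
      by (simp add: sum_subtractf sum_divide_distrib)
    also have "(\<Sum>x\<in>?G. cos (2 * pi * (x $ i - x $ j))) = (if \<forall>x\<in>H. x $ i - x $ j \<in> \<int> then real m else 0)"
      unfolding m_def by (rule character_orthogonality) (auto simp: coordinate_Zn)
    also have "(\<Sum>x\<in>?G. cos (2 * pi * (x $ i + x $ j))) = (if \<forall>x\<in>H. x $ i + x $ j \<in> \<int> then real m else 0)"
      unfolding m_def by (rule character_orthogonality) (auto simp: coordinate_Zn)
    finally show ?thesis by simp
  qed
  ultimately have "(\<Sum>i\<in>UNIV. u $ i * (m / 2 * ((if \<forall>x\<in>H. x $ i - x $ j \<in> \<int> then 1 else 0)
      - (if \<forall>x\<in>H. x $ i + x $ j \<in> \<int> then 1 else 0)))) = 0" by simp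
  then have "m / 2 * (\<Sum>i\<in>UNIV. u $ i * ((if \<forall>x\<in>H. x $ i - x $ j \<in> \<int> then 1 else 0)
      - (if \<forall>x\<in>H. x $ i + x $ j \<in> \<int> then 1 else 0))) = 0"
    by (simp add: sum_distrib_left mult_ac)
  then have "(\<Sum>i\<in>UNIV. (if \<forall>x\<in>H. x $ i - x $ j \<in> \<int> then u $ i else 0)
      - (if \<forall>x\<in>H. x $ i + x $ j \<in> \<int> then u $ i else 0)) = 0"
    using m by (simp add: if_distrib[of "\<lambda>t. _ * t"] right_diff_distrib cong: if_cong)
  then show ?thesis by (simp add: sum_subtractf sum.If_cases)
qed

end

section \<open>Even and odd parts of the fractional part sums, and sufficiency\<close>

lemma frac_eq_sawtooth: "frac t = sawtooth t + 1 / 2 * (if t \<in> \<int> then 0 else 1)"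
  by (simp add: sawtooth_def)

lemma sawtooth_uminus: "sawtooth (- t) = - sawtooth t"
  by (simp add: sawtooth_def frac_neg minus_in_Ints_iff)

lemma sawtooth_cong:
  assumes "s - t \<in> \<int>"
  shows "sawtooth s = sawtooth t"
proof -
  obtain n where "s = t + of_int n" using assms by (metis Ints_cases add.commute diff_add_cancel)
  then show ?thesis by (simp add: sawtooth_def frac_def)
qed

context integral_subgroup
begin

text \<open>Under \<open>x \<mapsto> - x\<close> the sawtooth sum changes sign and the integrality
  sum does not, so adding and subtracting the hypotheses at \<open>x\<close> and \<open>- x\<close>
  separates them.\<close>

lemma frac_sums_split:
  fixes u :: "real ^ 'n"
  assumes zero: "\<And>x. x \<in> H \<Longrightarrow> (\<Sum>i\<in>UNIV. u $ i * frac (x $ i)) = 0" and x: "x \<in> H"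
  shows "(\<Sum>i\<in>UNIV. u $ i * sawtooth (x $ i)) = 0"
    and "(\<Sum>i\<in>UNIV. u $ i * (if x $ i \<in> \<int> then 0 else 1)) = 0"
proof -
  let ?S = "\<Sum>i\<in>UNIV. u $ i * sawtooth (x $ i)"
  let ?E = "\<Sum>i\<in>UNIV. u $ i * (if x $ i \<in> \<int> then 0 else 1)"
  have "?S + 1 / 2 * ?E = (\<Sum>i\<in>UNIV. u $ i * frac (x $ i))"
    unfolding sum_distrib_left sum.distrib[symmetric]
    by (intro sum.cong refl) (simp add: frac_eq_sawtooth distrib_left)
  moreover have "- ?S + 1 / 2 * ?E = (\<Sum>i\<in>UNIV. u $ i * frac ((- x) $ i))"
    unfolding sum_distrib_left sum_negf[symmetric] sum.distrib[symmetric]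
    by (intro sum.cong refl) (simp add: frac_eq_sawtooth sawtooth_uminus algebra_simps minus_in_Ints_iff)
  ultimately have "?S + 1 / 2 * ?E = 0" "- ?S + 1 / 2 * ?E = 0"
    using zero[OF x] zero[OF uminus_mem[OF x]] by simp_all
  then show "?S = 0" "?E = 0" by linarith+
qed

text \<open>Averaging replaces a choice of class representatives: the condition for each
  \<open>j\<close> is multiplied by \<open>sawtooth (x $ j) / w j\<close> and summed over
  \<open>j\<close>, which reproduces the sawtooth sum. The integrality part is summed kernel by
  kernel.\<close>

lemma frac_sum_zero_of_class_sums:
  fixes u :: "real ^ 'n"
  assumes opp: "\<And>j. (\<Sum>i | \<forall>x\<in>H. x $ i - x $ j \<in> \<int>. u $ i) = (\<Sum>i | \<forall>x\<in>H. x $ i + x $ j \<in> \<int>. u $ i)"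
    and ker: "\<And>j. (\<Sum>i | coord_kernel i = coord_kernel j. u $ i) = 0"
    and x: "x \<in> H"
  shows "(\<Sum>i\<in>UNIV. u $ i * frac (x $ i)) = 0"
proof -
  define P where "P i j \<longleftrightarrow> (\<forall>x\<in>H. x $ i - x $ j \<in> \<int>)" for i j
  define N where "N i j \<longleftrightarrow> (\<forall>x\<in>H. x $ i + x $ j \<in> \<int>)" for i j
  have Ints_add_iff: "a + b \<in> \<int> \<longleftrightarrow> a \<in> \<int>" if "b \<in> \<int>" for a b :: real
    using Ints_add[of a b] Ints_diff[of "a + b" b] that by auto
  have Ints_comm: "a - b \<in> \<int> \<longleftrightarrow> b - a \<in> \<int>" for a b :: real
    using minus_in_Ints_iff[of "a - b"] by simp
  have P_refl: "P i i" and P_sym: "P i j \<longleftrightarrow> P j i" and N_sym: "N i j \<longleftrightarrow> N j i" for i j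
    by (auto simp: P_def N_def Ints_comm[of "_ $ i"] add.commute)
  have PP: "P l i \<longleftrightarrow> P l j" and PN: "N l i \<longleftrightarrow> N l j" if "P i j" for i j l
  proof -
    have "x $ l - x $ j \<in> \<int> \<longleftrightarrow> x $ l - x $ i \<in> \<int>" "x $ l + x $ i \<in> \<int> \<longleftrightarrow> x $ l + x $ j \<in> \<int>"
      if "x \<in> H" for x
      using Ints_add_iff[of "x $ i - x $ j" "x $ l - x $ i"] Ints_add_iff[of "x $ i - x $ j" "x $ l + x $ j"]
        \<open>P i j\<close> that by (simp_all add: P_def)
    then show "P l i \<longleftrightarrow> P l j" "N l i \<longleftrightarrow> N l j" by (simp_all add: P_def N_def)
  qed
  have NP: "P l i \<longleftrightarrow> N l j" if "N i j" for i j l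
  proof -
    have "x $ l + x $ j \<in> \<int> \<longleftrightarrow> x $ l - x $ i \<in> \<int>" if "x \<in> H" for x
      using Ints_add_iff[of "x $ i + x $ j" "x $ l - x $ i"] \<open>N i j\<close> that by (simp add: N_def)
    then show ?thesis by (simp add: P_def N_def)
  qed
  \<comment> \<open>The size of the class of \<open>i\<close> up to sign, an index being counted
    twice if both relations hold. It is constant on the class and so normalises the average.\<close>
  define w where "w i = real (card {j. P j i} + card {j. N j i})" for i
  have w_pos: "w i > 0" for i
    using P_refl[of i] by (auto simp: w_def card_gt_0_iff intro!: add_pos_nonneg)
  have w_eq: "w j = w i" if "P i j \<or> N i j" for i j
  proof (cases "P i j")
    case True
    then show ?thesis unfolding w_def using PP[OF True] PN[OF True] by simp
  next
    case False
    then have "N i j" "N j i" using that N_sym by auto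
    then show ?thesis unfolding w_def using NP[of i j] NP[of j i] by simp
  qed
  \<comment> \<open>The minus sign on the left is absorbed by oddness of the sawtooth. If
    \<open>P i j\<close> and \<open>N i j\<close> both hold, the sawtooth values equal their own
    negatives and both sides vanish.\<close>
  have saw: "sawtooth (x $ j) / w j * ((if P i j then 1 else 0) - (if N i j then 1 else 0))
      = sawtooth (x $ i) / w i * ((if P j i then 1 else 0) + (if N j i then 1 else 0))" for i j
  proof -
    have "sawtooth (x $ j) = sawtooth (x $ i)" if "P i j"
      using that x by (intro sawtooth_cong[symmetric]) (simp add: P_def)
    moreover have "sawtooth (x $ j) = - sawtooth (x $ i)" if "N i j"
      using that x by (subst sawtooth_uminus[symmetric], intro sawtooth_cong) (simp add: N_def add.commute)
    ultimately show ?thesis using w_eq[of i j] P_sym[of i j] N_sym[of i j] by auto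
  qed
  have "0 = (\<Sum>j\<in>UNIV. sawtooth (x $ j) / w j * ((\<Sum>i | P i j. u $ i) - (\<Sum>i | N i j. u $ i)))"
    using opp by (simp add: P_def N_def)
  also have "\<dots> = (\<Sum>j\<in>UNIV. \<Sum>i\<in>UNIV. u $ i * (sawtooth (x $ j) / w j
      * ((if P i j then 1 else 0) - (if N i j then 1 else 0))))"
  proof (intro sum.cong refl)
    fix j
    have "(\<Sum>i | P i j. u $ i) - (\<Sum>i | N i j. u $ i)
        = (\<Sum>i\<in>UNIV. u $ i * ((if P i j then 1 else 0) - (if N i j then 1 else 0)))"
      by (simp add: right_diff_distrib sum_subtractf if_distrib[of "\<lambda>t. _ * t"] sum.If_cases cong: if_cong)
    then show "sawtooth (x $ j) / w j * ((\<Sum>i | P i j. u $ i) - (\<Sum>i | N i j. u $ i))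
        = (\<Sum>i\<in>UNIV. u $ i * (sawtooth (x $ j) / w j * ((if P i j then 1 else 0) - (if N i j then 1 else 0))))"
      by (simp only: sum_distrib_left mult_ac)
  qed
  also have "\<dots> = (\<Sum>i\<in>UNIV. u $ i * (\<Sum>j\<in>UNIV. sawtooth (x $ i) / w i
      * ((if P j i then 1 else 0) + (if N j i then 1 else 0))))"
    unfolding saw by (subst sum.swap) (simp only: sum_distrib_left)
  also have "\<dots> = (\<Sum>i\<in>UNIV. u $ i * sawtooth (x $ i))"
  proof (intro sum.cong refl)
    fix i
    have "(\<Sum>j\<in>UNIV. (if P j i then 1 else 0) + (if N j i then 1 else 0)) = w i"
      by (simp add: w_def sum.distrib sum.If_cases)
    then show "u $ i * (\<Sum>j\<in>UNIV. sawtooth (x $ i) / w i * ((if P j i then 1 else 0) + (if N j i then 1 else 0)))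
        = u $ i * sawtooth (x $ i)"
      unfolding sum_distrib_left[symmetric] using w_pos[of i] by simp
  qed
  finally have odd: "(\<Sum>i\<in>UNIV. u $ i * sawtooth (x $ i)) = 0" by simp
  \<comment> \<open>Integrality of \<open>x $ i\<close> depends on \<open>i\<close> only through its
    kernel, so the sum splits into the vanishing kernel sums.\<close>
  have "(\<Sum>i\<in>UNIV. u $ i * (if x $ i \<in> \<int> then 0 else 1))
      = (\<Sum>i\<in>UNIV. u $ i * (if x \<in> coord_kernel i then 0 else 1))"
    using x by (simp add: coord_kernel_def)
  also have "\<dots> = (\<Sum>X\<in>range coord_kernel. \<Sum>i | i \<in> UNIV \<and> coord_kernel i = X.
      u $ i * (if x \<in> coord_kernel i then 0 else 1))"
    by (rule sum.image_gen) simp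
  also have "\<dots> = 0"
  proof (rule sum.neutral, rule ballI)
    fix X assume "X \<in> range coord_kernel"
    then obtain j where X: "X = coord_kernel j" by blast
    have "(\<Sum>i | i \<in> UNIV \<and> coord_kernel i = X. u $ i * (if x \<in> coord_kernel i then 0 else 1))
        = (\<Sum>i | coord_kernel i = coord_kernel j. u $ i) * (if x \<in> coord_kernel j then 0 else 1)"
      unfolding sum_distrib_right by (intro sum.cong) (auto simp: X)
    then show "(\<Sum>i | i \<in> UNIV \<and> coord_kernel i = X. u $ i * (if x \<in> coord_kernel i then 0 else 1)) = 0"
      by (simp add: ker)
  qed
  finally have even: "(\<Sum>i\<in>UNIV. u $ i * (if x $ i \<in> \<int> then 0 else 1)) = 0" .
  have "(\<Sum>i\<in>UNIV. u $ i * frac (x $ i)) = (\<Sum>i\<in>UNIV. u $ i * sawtooth (x $ i))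
      + 1 / 2 * (\<Sum>i\<in>UNIV. u $ i * (if x $ i \<in> \<int> then 0 else 1))"
    unfolding sum_distrib_left sum.distrib[symmetric]
    by (intro sum.cong refl) (simp add: frac_eq_sawtooth distrib_left)
  then show ?thesis using odd even by simp
qed

lemma inner_cube_zero_iff:
  fixes u :: "real ^ 'n"
  shows "(\<forall>x\<in>H \<inter> half_open_cube. u \<bullet> x = 0) \<longleftrightarrow> (\<forall>x\<in>H. (\<Sum>i\<in>UNIV. u $ i * frac (x $ i)) = 0)"
proof -
  have "u \<bullet> frac_vec x = (\<Sum>i\<in>UNIV. u $ i * frac (x $ i))" for x
    by (simp add: inner_vec_def frac_vec_def)
  then show ?thesis
    using frac_vec_mem frac_vec_in_cube frac_vec_cube by (metis Int_iff)
qed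

lemma inner_cube_zero_iff_class_sums:
  fixes u :: "real ^ 'n"
  assumes "\<And>i. coord_kernel i \<noteq> H"
  shows "(\<forall>x\<in>H \<inter> half_open_cube. u \<bullet> x = 0) \<longleftrightarrow>
    (\<forall>j. (\<Sum>i | \<forall>x\<in>H. x $ i - x $ j \<in> \<int>. u $ i) = (\<Sum>i | \<forall>x\<in>H. x $ i + x $ j \<in> \<int>. u $ i)
      \<and> (\<Sum>i | coord_kernel i = coord_kernel j. u $ i) = 0)"
  unfolding inner_cube_zero_iff
  using frac_sums_split[of u] kernel_sums_zero[OF assms, of u] opposite_sums_equal[of u]
    frac_sum_zero_of_class_sums[of u] by blast

end

text \<open>Translation carries the isolation radius at 0 to every point, so \<open>L\<close> is
  uniformly discrete and meets the bounded cube in a finite set.\<close>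

lemma integral_subgroup_lattice:
  assumes "is_lattice L" "Zn \<subseteq> L"
  shows "integral_subgroup L"
proof -
  have sg: "subgroup L (additive_group UNIV)" and disc: "discrete L"
    using assms by (auto simp: is_lattice_def)
  have 0: "0 \<in> L" using subgroup.one_closed[OF sg] by (simp add: additive_group_def)
  have add: "x + y \<in> L" if "x \<in> L" "y \<in> L" for x y
    using subgroup.m_closed[OF sg that] by (simp add: additive_group_def)
  have neg: "- x \<in> L" if "x \<in> L" for x
    using subgroup.m_inv_closed[OF sg that] by (simp add: inv_additive_UNIV)
  obtain e where e: "e > 0" "\<And>y. y \<in> L \<Longrightarrow> dist 0 y < e \<Longrightarrow> y = 0"
    using discreteD[OF disc 0] by (auto simp: isolated_in_dist_Ex_iff)
  have "x = y" if "x \<in> L" "y \<in> L" "dist x y < e" for x y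
    using e(2)[of "x - y"] add[OF that(1) neg[OF that(2)]] that(3) by (simp add: dist_norm norm_minus_commute)
  then have "uniform_discrete L" using e(1) by (auto simp: uniform_discrete_def)
  then have "uniform_discrete (L \<inter> half_open_cube)" by (rule uniform_discrete_subset) auto
  moreover have "bounded (half_open_cube :: (real ^ 'a) set)"
    by (rule bounded_subset[of "cbox 0 1"]) (auto simp: half_open_cube_def mem_box_cart less_imp_le)
  then have "bounded (L \<inter> half_open_cube)" by (rule bounded_subset) auto
  ultimately have "finite (L \<inter> half_open_cube)" using uniform_discrete_finite_iff by blast
  then show ?thesis using 0 add neg assms(2) by unfold_locales auto
qed

section \<open>Equalities of quotient homomorphisms and kernels in terms of coordinates\<close>

lemma Ints_coset_eq_iff:
  "\<int> #>\<^bsub>additive_group UNIV\<^esub> a = \<int> #>\<^bsub>additive_group UNIV\<^esub> b \<longleftrightarrow> a - b \<in> \<int>" for a b :: real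
proof -
  have mem: "c \<in> \<int> #>\<^bsub>additive_group UNIV\<^esub> d \<longleftrightarrow> c - d \<in> \<int>" for c d :: real
    by (force simp: r_coset_def additive_group_def)
  show ?thesis
  proof
    assume "\<int> #>\<^bsub>additive_group UNIV\<^esub> a = \<int> #>\<^bsub>additive_group UNIV\<^esub> b"
    then show "a - b \<in> \<int>" using mem[of a a] mem[of a b] by simp
  next
    assume ab: "a - b \<in> \<int>"
    have "c - a \<in> \<int> \<longleftrightarrow> c - b \<in> \<int>" for c
      using Ints_add[of "c - a" "a - b"] Ints_diff[of "c - b" "a - b"] ab by auto
    then show "\<int> #>\<^bsub>additive_group UNIV\<^esub> a = \<int> #>\<^bsub>additive_group UNIV\<^esub> b"
      using mem by blast
  qed
qed

lemma carrier_mod_Zn: "carrier (mod_Zn L) = (\<lambda>x. Zn #>\<^bsub>additive_group L\<^esub> x) ` L"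
  by (auto simp: carrier_FactGroup additive_group_def)

lemma restrict_mod_Zn_eq_iff:
  assumes "f \<in> extensional (carrier (mod_Zn L))" "g \<in> extensional (carrier (mod_Zn L))"
  shows "f = g \<longleftrightarrow> (\<forall>x\<in>L. f (Zn #>\<^bsub>additive_group L\<^esub> x) = g (Zn #>\<^bsub>additive_group L\<^esub> x))"
  using extensionalityI[OF assms] by (auto simp: carrier_mod_Zn)

lemma coord_proj_eq_iff:
  "coord_proj L i = coord_proj L j \<longleftrightarrow> (\<forall>x\<in>L. x $ i - x $ j \<in> \<int>)"
proof -
  have "coord_proj L i \<in> extensional (carrier (mod_Zn L))" for i
    by (simp add: coord_proj_def)
  then show ?thesis
    by (subst restrict_mod_Zn_eq_iff) (auto simp: coord_proj_coset simp flip: Ints_coset_eq_iff)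
qed

lemma coord_proj_eq_neg_iff:
  fixes L :: "(real ^ 'n) set"
  shows "coord_proj L i = neg_hom (mod_Zn L) R_mod_Z (coord_proj L j) \<longleftrightarrow> (\<forall>x\<in>L. x $ i + x $ j \<in> \<int>)"
proof -
  interpret R: normal "\<int> :: real set" "additive_group UNIV" by (rule normal_Ints)
  have inv: "inv\<^bsub>R_mod_Z\<^esub> (\<int> #>\<^bsub>additive_group UNIV\<^esub> a) = \<int> #>\<^bsub>additive_group UNIV\<^esub> (- a)" for a :: real
  proof -
    have a: "a \<in> carrier (additive_group UNIV)" by (simp add: additive_group_def)
    then have "\<int> #>\<^bsub>additive_group UNIV\<^esub> a \<in> carrier R_mod_Z" by (auto simp: carrier_FactGroup)
    then show ?thesis
      using R.inv_FactGroup R.rcos_inv[OF a] by (simp add: inv_additive_UNIV)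
  qed
  have "neg_hom (mod_Zn L) R_mod_Z (coord_proj L j) (Zn #>\<^bsub>additive_group L\<^esub> x)
      = \<int> #>\<^bsub>additive_group UNIV\<^esub> (- x $ j)" if "x \<in> L" for x
    using that by (simp add: neg_hom_def carrier_mod_Zn coord_proj_coset inv)
  moreover have "coord_proj L i \<in> extensional (carrier (mod_Zn L))"
    "neg_hom (mod_Zn L) R_mod_Z (coord_proj L j) \<in> extensional (carrier (mod_Zn L))"
    by (auto simp: coord_proj_def neg_hom_def)
  moreover have "x $ i + x $ j \<in> \<int> \<longleftrightarrow> \<int> #>\<^bsub>additive_group UNIV\<^esub> x $ i = \<int> #>\<^bsub>additive_group UNIV\<^esub> - x $ j" for x :: "real ^ 'n"
    by (simp add: Ints_coset_eq_iff)
  ultimately show ?thesis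
    by (subst restrict_mod_Zn_eq_iff) (auto simp: coord_proj_coset)
qed

lemma coset_mem_coord_ker_iff:
  assumes "x \<in> L"
  shows "Zn #>\<^bsub>additive_group L\<^esub> x \<in> coord_ker L i \<longleftrightarrow> x $ i \<in> \<int>"
proof -
  have "\<int> #>\<^bsub>additive_group UNIV\<^esub> (0::real) = \<int>"
    by (auto simp: r_coset_def additive_group_def)
  then show ?thesis
    using assms Ints_coset_eq_iff[of "x $ i" 0] by (simp add: kernel_def carrier_mod_Zn coord_proj_coset)
qed

lemma coord_ker_eq: "coord_ker L i = (\<lambda>x. Zn #>\<^bsub>additive_group L\<^esub> x) ` {x \<in> L. x $ i \<in> \<int>}"
proof (rule equalityI; rule subsetI)
  fix X assume X: "X \<in> coord_ker L i"
  then have "X \<in> carrier (mod_Zn L)" by (simp add: kernel_def)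
  then obtain x where x: "x \<in> L" "X = Zn #>\<^bsub>additive_group L\<^esub> x" unfolding carrier_mod_Zn by blast
  then have "x $ i \<in> \<int>" using X coset_mem_coord_ker_iff by blast
  then show "X \<in> (\<lambda>x. Zn #>\<^bsub>additive_group L\<^esub> x) ` {x \<in> L. x $ i \<in> \<int>}" using x by blast
next
  fix X assume "X \<in> (\<lambda>x. Zn #>\<^bsub>additive_group L\<^esub> x) ` {x \<in> L. x $ i \<in> \<int>}"
  then show "X \<in> coord_ker L i" using coset_mem_coord_ker_iff by blast
qed

lemma coord_ker_eq_iff:
  "coord_ker L i = coord_ker L j \<longleftrightarrow> {x \<in> L. x $ i \<in> \<int>} = {x \<in> L. x $ j \<in> \<int>}"
proof
  assume "coord_ker L i = coord_ker L j"
  then show "{x \<in> L. x $ i \<in> \<int>} = {x \<in> L. x $ j \<in> \<int>}"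
    using coset_mem_coord_ker_iff[of _ L i] coset_mem_coord_ker_iff[of _ L j] by blast
qed (simp add: coord_ker_eq)

theorem theorem3p1:
  fixes L :: "(real ^ 'n) set" and u :: "real ^ 'n"
  assumes "is_lattice L" and "Zn \<subseteq> L"
    and "\<And>i. coord_ker L i \<noteq> carrier (mod_Zn L)"
  shows "(\<forall>x \<in> L \<inter> half_open_cube. u \<bullet> x = 0) \<longleftrightarrow>
    (\<forall>j. (\<Sum>i | coord_proj L i = coord_proj L j. u $ i)
           = (\<Sum>i | coord_proj L i = neg_hom (mod_Zn L) R_mod_Z (coord_proj L j). u $ i)
       \<and> (\<Sum>i | coord_ker L i = coord_ker L j. u $ i) = 0)"
proof -
  interpret integral_subgroup L
    by (rule integral_subgroup_lattice[OF assms(1,2)])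
  have "coord_kernel i \<noteq> L" for i
    using assms(3)[of i] by (auto simp: coord_kernel_def coord_ker_eq carrier_mod_Zn)
  from inner_cube_zero_iff_class_sums[OF this] show ?thesis
    unfolding coord_proj_eq_iff coord_proj_eq_neg_iff coord_ker_eq_iff coord_kernel_def .
qed

end
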